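(* Consider a sequence of multiple testing problems indexed by the number of tests $m\to\infty$, with parameters $p=p_m$, $\tau^2=\tau_m^2$, $\sigma^2=\sigma_m^2$, $\delta_0=\delta_{0m}$, $\delta_A=\delta_{Am}$ such that, with $u=\tau^2/\sigma^2$, $f=(1-p)/p$, $\delta=\delta_0/\delta_A$ and $v=uf^2\delta^2$, as $m\to\infty$: $p\to 0$, $u\to\infty$, $v\to\infty$ and $\frac{\log v}{u}\to C\in(0,\infty)$. Assume moreover that $mp_m\to s\in(0,\infty]$. Let $\alpha_m\in(0,1)$ be FDR levels such that (i) $\alpha_m\to\alpha_\infty<1$; (ii) with $r_{\alpha_m}=\frac{\alpha_m}{1-\alpha_m}$ and $s_m$ defined by $\frac{\log(f\delta\sqrt u)}{\log(f/r_{\alpha_m})}=1+s_m$, one has $s_m\to0$ and $2s_m\log(f/r_{\alpha_m})-\log\log(f/r_{\alpha_m})\to-\infty$. Then the Benjamini–Hochberg procedure at the FDR level $\alpha_m$ is ABOS.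
   Context: Model. Given a number of tests $m\ge 1$ and parameters $p\in(0,1)$, $\sigma^2>0$ (known), $\tau^2>0$, let $(\nu_i,X_i)$, $i=1,\dots,m$, be i.i.d. with $P(\nu_i=1)=p=1-P(\nu_i=0)$, $X_i\mid\nu_i=0\sim N(0,\sigma^2)$ and $X_i\mid\nu_i=1\sim N(0,\sigma^2+\tau^2)$. Only the $X_i$ are observed. The null hypothesis $H_{0i}$ is the event $\nu_i=0$, the alternative $H_{Ai}$ is $\nu_i=1$. A type I error (rejecting a true $H_{0i}$) costs $\delta_0>0$, a type II error (accepting $H_{0i}$ when $H_{Ai}$ holds) costs $\delta_A>0$, and the total loss is the sum over the $m$ tests. The Bayes risk of a multiple testing rule is $R=\delta_0E(V)+\delta_AE(T)$, where $V$ is the number of false rejections and $T$ the number of false acceptances. Bayes oracle: the rule minimizing $R$; it rejects $H_{0i}$ iff $X_i^2/\sigma^2\ge(1+\frac1u)\left(\log v+\log(1+\frac1u)\right)$, where $u=\tau^2/\sigma^2$, $f=(1-p)/p$, $\delta=\delta_0/\delta_A$, $v=uf^2\delta^2$. Its Bayes risk is denoted $R_{\mathrm{opt}}$. ABOS (asymptotically Bayes optimal under sparsity): a rule with risk $R$ is ABOS if $R/R_{\mathrm{opt}}\to1$ as $m\to\infty$. Benjamini–Hochberg procedure (BH) at FDR level $\alpha$: let $Z_i=|X_i|/\sigma$, $p_i=2(1-\Phi(Z_i))$ ($\Phi$ the standard normal cdf), $p_{(1)}\le\dots\le p_{(m)}$ the ordered $p$-values, and $k=\max\{i: p_{(i)}\le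 i\alpha/m\}$. BH rejects all null hypotheses whose $p$-value is at most $p_{(k)}$ (and rejects nothing if no such $i$ exists). *)

theory Defs
  imports "HOL-Probability.Probability"
begin

text \<open>
  The normal law with mean \<open>0\<close> and standard deviation \<open>s\<close>.  The parameters \<open>\<sigma>\<close>, \<open>\<tau>\<close> below are
  standard deviations, that is, the positive square roots of \<open>\<sigma>\<^sup>2\<close>, \<open>\<tau>\<^sup>2\<close>.
\<close>

definition centred_normal :: "real \<Rightarrow> real measure" where
  "centred_normal s = density lborel (\<lambda>x. ennreal (normal_density 0 s x))"

text \<open>
  \<open>\<nu> i\<close> is the event that the alternative holds in test \<open>i\<close>.  That the pairs \<open>(\<nu> i, X i)\<close> are
  identically distributed follows from the last three assumptions.
\<close>

locale two_groups_model = prob_space M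
  for M :: "'a measure" +
  fixes m :: nat and p \<sigma> \<tau> :: real
    and \<nu> :: "nat \<Rightarrow> 'a \<Rightarrow> bool" and X :: "nat \<Rightarrow> 'a \<Rightarrow> real"
  assumes m_ge_1: "m \<ge> 1"
    and p_pos: "0 < p" and p_less_1: "p < 1"
    and sigma_pos: "0 < \<sigma>" and tau_pos: "0 < \<tau>"
    and indep: "indep_vars (\<lambda>_. count_space UNIV \<Otimes>\<^sub>M borel) (\<lambda>i \<omega>. (\<nu> i \<omega>, X i \<omega>)) {1..m}"
    and prob_alternative: "\<And>i. i \<in> {1..m} \<Longrightarrow> \<P>(\<omega> in M. \<nu> i \<omega>) = p"
    and law_null: "\<And>i A. i \<in> {1..m} \<Longrightarrow> A \<in> sets borel \<Longrightarrow>
      \<P>(\<omega> in M. X i \<omega> \<in> A \<bar> \<not> \<nu> i \<omega>) = measure (centred_normal \<sigma>) A"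
    and law_alternative: "\<And>i A. i \<in> {1..m} \<Longrightarrow> A \<in> sets borel \<Longrightarrow>
      \<P>(\<omega> in M. X i \<omega> \<in> A \<bar> \<nu> i \<omega>) = measure (centred_normal (sqrt (\<sigma>\<^sup>2 + \<tau>\<^sup>2))) A"

text \<open>A rule maps the observations \<open>x 1, \<dots>, x m\<close> to the set of indices of the rejected hypotheses.\<close>

type_synonym testing_rule = "(nat \<Rightarrow> real) \<Rightarrow> nat set"

definition observations :: "nat \<Rightarrow> (nat \<Rightarrow> 'a \<Rightarrow> real) \<Rightarrow> 'a \<Rightarrow> nat \<Rightarrow> real" where
  "observations m X \<omega> = (\<lambda>i\<in>{1..m}. X i \<omega>)"

definition false_rejections ::
    "nat \<Rightarrow> (nat \<Rightarrow> 'a \<Rightarrow> bool) \<Rightarrow> (nat \<Rightarrow> 'a \<Rightarrow> real) \<Rightarrow> testing_rule \<Rightarrow> 'a \<Rightarrow> nat" where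
  "false_rejections m \<nu> X d \<omega> = card {i \<in> {1..m}. \<not> \<nu> i \<omega> \<and> i \<in> d (observations m X \<omega>)}"

definition false_acceptances ::
    "nat \<Rightarrow> (nat \<Rightarrow> 'a \<Rightarrow> bool) \<Rightarrow> (nat \<Rightarrow> 'a \<Rightarrow> real) \<Rightarrow> testing_rule \<Rightarrow> 'a \<Rightarrow> nat" where
  "false_acceptances m \<nu> X d \<omega> = card {i \<in> {1..m}. \<nu> i \<omega> \<and> i \<notin> d (observations m X \<omega>)}"

definition bayes_risk ::
    "'a measure \<Rightarrow> nat \<Rightarrow> real \<Rightarrow> real \<Rightarrow> (nat \<Rightarrow> 'a \<Rightarrow> bool) \<Rightarrow> (nat \<Rightarrow> 'a \<Rightarrow> real) \<Rightarrow>
      testing_rule \<Rightarrow> real" where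
  "bayes_risk M m \<delta>\<^sub>0 \<delta>\<^sub>A \<nu> X d =
     \<delta>\<^sub>0 * (\<integral>\<omega>. real (false_rejections m \<nu> X d \<omega>) \<partial>M) +
     \<delta>\<^sub>A * (\<integral>\<omega>. real (false_acceptances m \<nu> X d \<omega>) \<partial>M)"

definition oracle_threshold :: "real \<Rightarrow> real \<Rightarrow> real \<Rightarrow> real \<Rightarrow> real \<Rightarrow> real" where
  "oracle_threshold p \<sigma> \<tau> \<delta>\<^sub>0 \<delta>\<^sub>A =
     (let u = \<tau>\<^sup>2 / \<sigma>\<^sup>2; f = (1 - p) / p; \<delta> = \<delta>\<^sub>0 / \<delta>\<^sub>A; v = u * f\<^sup>2 * \<delta>\<^sup>2
      in (1 + 1 / u) * (ln v + ln (1 + 1 / u)))"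

definition bayes_oracle :: "nat \<Rightarrow> real \<Rightarrow> real \<Rightarrow> real \<Rightarrow> real \<Rightarrow> real \<Rightarrow> testing_rule" where
  "bayes_oracle m p \<sigma> \<tau> \<delta>\<^sub>0 \<delta>\<^sub>A x =
     {i \<in> {1..m}. (x i)\<^sup>2 / \<sigma>\<^sup>2 \<ge> oracle_threshold p \<sigma> \<tau> \<delta>\<^sub>0 \<delta>\<^sub>A}"

definition optimal_risk ::
    "'a measure \<Rightarrow> nat \<Rightarrow> real \<Rightarrow> real \<Rightarrow> real \<Rightarrow> real \<Rightarrow> real \<Rightarrow>
      (nat \<Rightarrow> 'a \<Rightarrow> bool) \<Rightarrow> (nat \<Rightarrow> 'a \<Rightarrow> real) \<Rightarrow> real" where
  "optimal_risk M m p \<sigma> \<tau> \<delta>\<^sub>0 \<delta>\<^sub>A \<nu> X =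
     bayes_risk M m \<delta>\<^sub>0 \<delta>\<^sub>A \<nu> X (bayes_oracle m p \<sigma> \<tau> \<delta>\<^sub>0 \<delta>\<^sub>A)"

definition p_value :: "real \<Rightarrow> real \<Rightarrow> real" where
  "p_value \<sigma> x = 2 * (1 - cdf std_normal_distribution (\<bar>x\<bar> / \<sigma>))"

text \<open>The \<open>i\<close>-th smallest of the \<open>m\<close> p-values, for \<open>i \<in> {1..m}\<close>.\<close>

definition ordered_p_value :: "nat \<Rightarrow> real \<Rightarrow> (nat \<Rightarrow> real) \<Rightarrow> nat \<Rightarrow> real" where
  "ordered_p_value m \<sigma> x i = sort (map (\<lambda>j. p_value \<sigma> (x j)) [1..<Suc m]) ! (i - 1)"

definition benjamini_hochberg :: "nat \<Rightarrow> real \<Rightarrow> real \<Rightarrow> testing_rule" where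
  "benjamini_hochberg m \<sigma> \<alpha> x =
     (let K = {i \<in> {1..m}. ordered_p_value m \<sigma> x i \<le> real i * \<alpha> / real m}
      in if K = {} then {}
         else {i \<in> {1..m}. p_value \<sigma> (x i) \<le> ordered_p_value m \<sigma> x (Max K)})"

text \<open>Asymptotic Bayes optimality under sparsity, in terms of the two risk sequences.\<close>

definition abos :: "(nat \<Rightarrow> real) \<Rightarrow> (nat \<Rightarrow> real) \<Rightarrow> bool" where
  "abos R R\<^sub>o\<^sub>p\<^sub>t \<longleftrightarrow> (\<lambda>m. R m / R\<^sub>o\<^sub>p\<^sub>t m) \<longlonglongrightarrow> 1"


text \<open>The oracle rule minimizes the Bayes risk among all measurable rules.\<close>

lemma oracle_threshold_iff:
  assumes "0 < p" "p < 1" "0 < \<sigma>" "0 < \<tau>" "0 < \<delta>\<^sub>0" "0 < \<delta>\<^sub>A"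
  shows "oracle_threshold p \<sigma> \<tau> \<delta>\<^sub>0 \<delta>\<^sub>A \<le> x\<^sup>2 / \<sigma>\<^sup>2 \<longleftrightarrow>
    \<delta>\<^sub>0 * ((1 - p) * normal_density 0 \<sigma> x) \<le> \<delta>\<^sub>A * (p * normal_density 0 (sqrt (\<sigma>\<^sup>2 + \<tau>\<^sup>2)) x)"
proof -
  define u where "u = \<tau>\<^sup>2 / \<sigma>\<^sup>2"
  define w where "w = (1 - p) / p * (\<delta>\<^sub>0 / \<delta>\<^sub>A)"
  have u: "u > 0" and w: "w > 0" using assms by (auto simp: u_def w_def)
  have st: "\<sigma>\<^sup>2 + \<tau>\<^sup>2 = \<sigma>\<^sup>2 * (1 + u)" using assms by (simp add: u_def field_simps)
  have thr: "oracle_threshold p \<sigma> \<tau> \<delta>\<^sub>0 \<delta>\<^sub>A = (1 + 1 / u) * ln (w\<^sup>2 * (1 + u))"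
  proof -
    have "ln (u * w\<^sup>2) + ln (1 + 1 / u) = ln (u * w\<^sup>2 * (1 + 1 / u))"
      using u w by (intro ln_mult_pos [symmetric]) (auto simp: add_pos_pos)
    also have "u * w\<^sup>2 * (1 + 1 / u) = w\<^sup>2 * (1 + u)" using u by (simp add: field_simps)
    finally show ?thesis
      by (simp add: oracle_threshold_def Let_def u_def [symmetric] w_def power_mult_distrib
          power_divide mult.assoc)
  qed
  define y where "y = x\<^sup>2 / \<sigma>\<^sup>2"
  define c where "c = 1 / sqrt (2 * pi * \<sigma>\<^sup>2)"
  have c: "c > 0" using assms by (simp add: c_def)
  have d0: "normal_density 0 \<sigma> x = c * exp (- y / 2)"
    by (simp add: normal_density_def c_def y_def)
  have d1: "normal_density 0 (sqrt (\<sigma>\<^sup>2 + \<tau>\<^sup>2)) x = c * exp (- y / (2 * (1 + u))) / sqrt (1 + u)"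
  proof -
    have sq: "(sqrt (\<sigma>\<^sup>2 + \<tau>\<^sup>2))\<^sup>2 = \<sigma>\<^sup>2 * (1 + u)"
      unfolding st using u by (intro real_sqrt_pow2) simp
    have "2 * pi * (\<sigma>\<^sup>2 * (1 + u)) = (2 * pi * \<sigma>\<^sup>2) * (1 + u)" by simp
    then have "sqrt (2 * pi * (\<sigma>\<^sup>2 * (1 + u))) = sqrt (2 * pi * \<sigma>\<^sup>2) * sqrt (1 + u)"
      by (simp only: real_sqrt_mult)
    moreover have "- (x - 0)\<^sup>2 / (2 * (\<sigma>\<^sup>2 * (1 + u))) = - y / (2 * (1 + u))"
      by (simp add: y_def)
    ultimately show ?thesis by (simp only: normal_density_def sq c_def) simp
  qed
  have "\<delta>\<^sub>0 * ((1 - p) * normal_density 0 \<sigma> x) \<le> \<delta>\<^sub>A * (p * normal_density 0 (sqrt (\<sigma>\<^sup>2 + \<tau>\<^sup>2)) x)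
    \<longleftrightarrow> c * (\<delta>\<^sub>A * p) * (w * exp (- y / 2)) \<le> c * (\<delta>\<^sub>A * p) * (exp (- y / (2 * (1 + u))) / sqrt (1 + u))"
  proof -
    have "\<delta>\<^sub>0 * ((1 - p) * normal_density 0 \<sigma> x) = c * (\<delta>\<^sub>A * p) * (w * exp (- y / 2))"
      unfolding d0 w_def using assms by (simp add: field_simps)
    moreover have "\<delta>\<^sub>A * (p * normal_density 0 (sqrt (\<sigma>\<^sup>2 + \<tau>\<^sup>2)) x)
        = c * (\<delta>\<^sub>A * p) * (exp (- y / (2 * (1 + u))) / sqrt (1 + u))"
      unfolding d1 by (simp add: field_simps)
    ultimately show ?thesis by simp
  qed
  also have "\<dots> \<longleftrightarrow> w * exp (- y / 2) \<le> exp (- y / (2 * (1 + u))) / sqrt (1 + u)"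
    using c assms by (subst mult_le_cancel_left_pos) auto
  also have "\<dots> \<longleftrightarrow> ln (w * exp (- y / 2)) \<le> ln (exp (- y / (2 * (1 + u))) / sqrt (1 + u))"
    using u w by (subst ln_le_cancel_iff) auto
  also have "ln (w * exp (- y / 2)) = ln w - y / 2"
    using w by (simp add: ln_mult)
  also have "ln (exp (- y / (2 * (1 + u))) / sqrt (1 + u)) = - y / (2 * (1 + u)) - ln (1 + u) / 2"
    using u by (simp add: ln_div ln_sqrt)
  also have "ln w - y / 2 \<le> - y / (2 * (1 + u)) - ln (1 + u) / 2 \<longleftrightarrow>
      2 * ln w + ln (1 + u) \<le> y * (u / (1 + u))"
  proof -
    have "y / 2 - y / (2 * (1 + u)) = y * (u / (1 + u)) / 2" using u by (simp add: field_simps)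
    moreover have "l - a \<le> - b - c / 2 \<longleftrightarrow> 2 * l + c \<le> d" if "a - b = d / 2"
      for a b c d l :: real using that by linarith
    ultimately show ?thesis by (simp only: minus_divide_left [symmetric])
  qed
  also have "2 * ln w + ln (1 + u) = ln (w\<^sup>2 * (1 + u))"
    using u w by (simp add: ln_mult ln_realpow)
  also have "ln (w\<^sup>2 * (1 + u)) \<le> y * (u / (1 + u)) \<longleftrightarrow> (1 + 1 / u) * ln (w\<^sup>2 * (1 + u)) \<le> y"
  proof -
    have "ln (w\<^sup>2 * (1 + u)) \<le> y * (u / (1 + u)) \<longleftrightarrow>
       (1 + 1 / u) * ln (w\<^sup>2 * (1 + u)) \<le> (1 + 1 / u) * (y * (u / (1 + u)))"
      using u by (subst mult_le_cancel_left_pos) (auto simp: add_pos_pos)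
    also have "(1 + 1 / u) * (y * (u / (1 + u))) = y"
    proof -
      have "1 + 1 / u = (1 + u) / u" using u by (simp add: field_simps)
      then have "(1 + 1 / u) * (u / (1 + u)) = 1" using u by simp
      then show ?thesis by (metis mult.left_commute mult.right_neutral)
    qed
    finally show ?thesis .
  qed
  finally show ?thesis by (simp add: thr y_def)
qed

context two_groups_model
begin

lemma measurable_pair:
  assumes "i \<in> {1..m}"
  shows "(\<lambda>\<omega>. (\<nu> i \<omega>, X i \<omega>)) \<in> M \<rightarrow>\<^sub>M count_space UNIV \<Otimes>\<^sub>M borel"
  using indep assms by (auto simp: indep_vars_def)

lemma measurable_nu [measurable]:
  assumes "i \<in> {1..m}"
  shows "\<nu> i \<in> M \<rightarrow>\<^sub>M count_space UNIV"
  using measurable_compose [OF measurable_pair [OF assms] measurable_fst] by simp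

lemma measurable_X [measurable]:
  assumes "i \<in> {1..m}"
  shows "X i \<in> borel_measurable M"
  using measurable_compose [OF measurable_pair [OF assms] measurable_snd] by simp

lemma measurable_observations [measurable]:
  "observations m X \<in> M \<rightarrow>\<^sub>M (\<Pi>\<^sub>M i\<in>{1..m}. borel)"
  unfolding observations_def by (rule measurable_restrict) (rule measurable_X)

lemma prob_null:
  assumes "i \<in> {1..m}"
  shows "\<P>(\<omega> in M. \<not> \<nu> i \<omega>) = 1 - p"
proof -
  have "{\<omega> \<in> space M. \<nu> i \<omega>} \<in> events" using assms by measurable
  from prob_neg [OF this] show ?thesis using prob_alternative [OF assms] by simp
qed

lemma joint_law:
  assumes i: "i \<in> {1..m}" and A: "A \<in> sets borel"
  shows "emeasure M {\<omega> \<in> space M. \<not> \<nu> i \<omega> \<and> X i \<omega> \<in> A} =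
           (\<integral>\<^sup>+x\<in>A. ennreal ((1 - p) * normal_density 0 \<sigma> x) \<partial>lborel)"
    and "emeasure M {\<omega> \<in> space M. \<nu> i \<omega> \<and> X i \<omega> \<in> A} =
           (\<integral>\<^sup>+x\<in>A. ennreal (p * normal_density 0 (sqrt (\<sigma>\<^sup>2 + \<tau>\<^sup>2)) x) \<partial>lborel)"
proof -
  have gen: "emeasure M {\<omega> \<in> space M. Q \<omega> \<and> X i \<omega> \<in> A} =
       (\<integral>\<^sup>+x\<in>A. ennreal (q * normal_density 0 s x) \<partial>lborel)"
    if q: "q > 0" and s: "s > 0" and Q: "\<P>(\<omega> in M. Q \<omega>) = q"
      and C: "\<P>(\<omega> in M. X i \<omega> \<in> A \<bar> Q \<omega>) = measure (centred_normal s) A" for Q q s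
  proof -
    have eq: "{\<omega> \<in> space M. Q \<omega> \<and> X i \<omega> \<in> A} = {\<omega> \<in> space M. X i \<omega> \<in> A \<and> Q \<omega>}" by auto
    have "\<P>(\<omega> in M. X i \<omega> \<in> A \<and> Q \<omega>) = q * measure (centred_normal s) A"
      using C q unfolding cond_prob_def Q by (simp add: field_simps)
    then have "emeasure M {\<omega> \<in> space M. Q \<omega> \<and> X i \<omega> \<in> A} = ennreal q * ennreal (measure (centred_normal s) A)"
      unfolding eq emeasure_eq_measure using q by (simp add: ennreal_mult)
    also have "ennreal (measure (centred_normal s) A) = emeasure (centred_normal s) A"
    proof -
      interpret N: prob_space "centred_normal s"
        unfolding centred_normal_def using s by (rule prob_space_normal_density)
      show ?thesis by (simp add: N.emeasure_eq_measure)
    qed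
    also have "ennreal q * emeasure (centred_normal s) A =
       (\<integral>\<^sup>+x. ennreal q * (ennreal (normal_density 0 s x) * indicator A x) \<partial>lborel)"
      unfolding centred_normal_def using A
      by (subst emeasure_density) (auto intro!: nn_integral_cmult [symmetric])
    also have "\<dots> = (\<integral>\<^sup>+x\<in>A. ennreal (q * normal_density 0 s x) \<partial>lborel)"
      using q by (intro nn_integral_cong) (auto simp: ennreal_mult mult.assoc)
    finally show ?thesis .
  qed
  show "emeasure M {\<omega> \<in> space M. \<not> \<nu> i \<omega> \<and> X i \<omega> \<in> A} =
           (\<integral>\<^sup>+x\<in>A. ennreal ((1 - p) * normal_density 0 \<sigma> x) \<partial>lborel)"
    using p_less_1 sigma_pos prob_null [OF i] law_null [OF i A] by (intro gen) auto
  show "emeasure M {\<omega> \<in> space M. \<nu> i \<omega> \<and> X i \<omega> \<in> A} =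
           (\<integral>\<^sup>+x\<in>A. ennreal (p * normal_density 0 (sqrt (\<sigma>\<^sup>2 + \<tau>\<^sup>2)) x) \<partial>lborel)"
    using p_pos sigma_pos prob_alternative [OF i] law_alternative [OF i A]
    by (intro gen) (auto simp: add_pos_nonneg)
qed

text \<open>
  A pointwise comparison of the weighted densities of \<open>X i\<close> on \<open>S\<close> carries over to all
  events \<open>observations m X \<in> B\<close> on which \<open>X i\<close> takes values in \<open>S\<close>.
\<close>

lemma compare_events:
  fixes S :: "real set" and B :: "(nat \<Rightarrow> real) set" and b :: bool
  assumes i: "i \<in> {1..m}" and B: "B \<in> sets (\<Pi>\<^sub>M i\<in>{1..m}. borel)"
    and BS: "\<And>x. x \<in> B \<Longrightarrow> x i \<in> S"
    and nonneg: "0 \<le> a" "0 \<le> a'"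
    and law: "\<And>A. A \<in> sets borel \<Longrightarrow> A \<subseteq> S \<Longrightarrow>
       ennreal a * emeasure M {\<omega> \<in> space M. \<nu> i \<omega> = b \<and> X i \<omega> \<in> A} \<le>
       ennreal a' * emeasure M {\<omega> \<in> space M. \<nu> i \<omega> = (\<not> b) \<and> X i \<omega> \<in> A}"
  shows "a * \<P>(\<omega> in M. \<nu> i \<omega> = b \<and> observations m X \<omega> \<in> B) \<le>
    a' * \<P>(\<omega> in M. \<nu> i \<omega> = (\<not> b) \<and> observations m X \<omega> \<in> B)"
proof -
  define J where "J = {1..m} - {i}"
  define P0 where "P0 = count_space (UNIV :: bool set) \<Otimes>\<^sub>M (borel :: real measure)"
  define P where "P = PiM {i} (\<lambda>_. P0)"
  define N where "N = PiM J (\<lambda>_. P0)"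
  define Y where "Y = (\<lambda>\<omega>. restrict (\<lambda>i. (\<nu> i \<omega>, X i \<omega>)) {i})"
  define Z where "Z = (\<lambda>\<omega>. restrict (\<lambda>i. (\<nu> i \<omega>, X i \<omega>)) J)"
  define upd where "upd z x = (\<lambda>j\<in>{1..m}. if j = i then x else snd (z j))"
    for z :: "nat \<Rightarrow> bool \<times> real" and x :: real
  have ind: "indep_var P Y N Z"
    unfolding P_def N_def P0_def Y_def Z_def
    by (rule indep_var_restrict [OF indep]) (use i in \<open>auto simp: J_def\<close>)
  then have Y: "Y \<in> M \<rightarrow>\<^sub>M P" and Z: "Z \<in> M \<rightarrow>\<^sub>M N"
    and prod: "distr M P Y \<Otimes>\<^sub>M distr M N Z = distr M (P \<Otimes>\<^sub>M N) (\<lambda>\<omega>. (Y \<omega>, Z \<omega>))"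
    by (auto simp: indep_var_distribution_eq)
  have Yi: "Y \<omega> i = (\<nu> i \<omega>, X i \<omega>)" for \<omega> by (simp add: Y_def)
  interpret PY: prob_space "distr M P Y" by (rule prob_space_distr [OF Y])
  interpret NZ: prob_space "distr M N Z" by (rule prob_space_distr [OF Z])
  interpret PN: pair_prob_space "distr M P Y" "distr M N Z" ..
  have upd: "(\<lambda>w. upd (z w) (x w)) \<in> K \<rightarrow>\<^sub>M (\<Pi>\<^sub>M i\<in>{1..m}. borel)"
    if z: "z \<in> K \<rightarrow>\<^sub>M N" and x: "x \<in> borel_measurable K" for z x and K :: "'c measure"
    unfolding upd_def
  proof (rule measurable_restrict)
    fix j assume j: "j \<in> {1..m}"
    show "(\<lambda>w. if j = i then x w else snd (z w j)) \<in> borel_measurable K"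
    proof (cases "j = i")
      case True
      with x show ?thesis by simp
    next
      case False
      then have "(\<lambda>g. g j) \<in> N \<rightarrow>\<^sub>M P0"
        using j unfolding N_def by (intro measurable_component_singleton) (auto simp: J_def)
      moreover have "snd \<in> P0 \<rightarrow>\<^sub>M borel" unfolding P0_def by (rule measurable_snd)
      ultimately have "(\<lambda>g. snd (g j)) \<in> borel_measurable N" by (rule measurable_compose)
      from measurable_compose [OF z this] False show ?thesis by simp
    qed
  qed
  define D where "D c = {w \<in> space (P \<Otimes>\<^sub>M N). fst (fst w i) = c \<and> upd (snd w) (snd (fst w i)) \<in> B}"
    for c :: bool
  have D [measurable]: "D c \<in> sets (P \<Otimes>\<^sub>M N)" for c
  proof -
    have comp: "(\<lambda>w. fst w i) \<in> P \<Otimes>\<^sub>M N \<rightarrow>\<^sub>M P0"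
      unfolding P_def
      by (rule measurable_compose [OF measurable_fst measurable_component_singleton]) simp
    have [measurable]: "(\<lambda>w. fst (fst w i)) \<in> P \<Otimes>\<^sub>M N \<rightarrow>\<^sub>M count_space UNIV"
      by (rule measurable_compose [OF comp]) (simp add: P0_def)
    have x: "(\<lambda>w. snd (fst w i)) \<in> P \<Otimes>\<^sub>M N \<rightarrow>\<^sub>M borel"
      by (rule measurable_compose [OF comp]) (simp add: P0_def)
    note B [measurable]
    have [measurable]: "(\<lambda>w. upd (snd w) (snd (fst w i))) \<in> P \<Otimes>\<^sub>M N \<rightarrow>\<^sub>M (\<Pi>\<^sub>M i\<in>{1..m}. borel)"
      by (rule upd [OF measurable_snd x])
    show ?thesis unfolding D_def by measurable
  qed
  have obs: "upd (Z \<omega>) (X i \<omega>) = observations m X \<omega>" for \<omega>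
    by (auto simp: upd_def Z_def J_def observations_def fun_eq_iff)
  have law_Y: "emeasure (distr M P Y) ((\<lambda>y. (y, z)) -` D c) =
      emeasure M {\<omega> \<in> space M. \<nu> i \<omega> = c \<and> X i \<omega> \<in> {x. upd z x \<in> B}}"
    if z: "z \<in> space (distr M N Z)" for z c
  proof -
    have "(\<lambda>y. (y, z)) -` D c \<in> sets P" by (rule sets_Pair2) (rule D)
    with Y have "emeasure (distr M P Y) ((\<lambda>y. (y, z)) -` D c) =
        emeasure M (Y -` (\<lambda>y. (y, z)) -` D c \<inter> space M)"
      by (rule emeasure_distr)
    also have "Y -` (\<lambda>y. (y, z)) -` D c \<inter> space M =
        {\<omega> \<in> space M. \<nu> i \<omega> = c \<and> X i \<omega> \<in> {x. upd z x \<in> B}}"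
      using measurable_space [OF Y] z by (auto simp: D_def Yi space_pair_measure)
    finally show ?thesis .
  qed
  have ev: "emeasure M {\<omega> \<in> space M. \<nu> i \<omega> = c \<and> observations m X \<omega> \<in> B} =
     (\<integral>\<^sup>+z. emeasure M {\<omega> \<in> space M. \<nu> i \<omega> = c \<and> X i \<omega> \<in> {x. upd z x \<in> B}} \<partial>distr M N Z)" for c
  proof -
    have "emeasure M {\<omega> \<in> space M. \<nu> i \<omega> = c \<and> observations m X \<omega> \<in> B} =
       emeasure (distr M (P \<Otimes>\<^sub>M N) (\<lambda>\<omega>. (Y \<omega>, Z \<omega>))) (D c)"
    proof (subst emeasure_distr)
      show "(\<lambda>\<omega>. (Y \<omega>, Z \<omega>)) \<in> M \<rightarrow>\<^sub>M P \<Otimes>\<^sub>M N" using Y Z by (rule measurable_Pair)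
      show "emeasure M {\<omega> \<in> space M. \<nu> i \<omega> = c \<and> observations m X \<omega> \<in> B} =
          emeasure M ((\<lambda>\<omega>. (Y \<omega>, Z \<omega>)) -` D c \<inter> space M)"
        using measurable_space [OF Y] measurable_space [OF Z]
        by (intro arg_cong [where f = "emeasure M"])
           (auto simp: D_def Yi obs space_pair_measure)
    qed (rule D)
    also have "\<dots> = emeasure (distr M P Y \<Otimes>\<^sub>M distr M N Z) (D c)" by (simp add: prod)
    also have "\<dots> = (\<integral>\<^sup>+z. emeasure (distr M P Y) ((\<lambda>y. (y, z)) -` D c) \<partial>distr M N Z)"
      by (rule PN.emeasure_pair_measure_alt2) simp
    also have "\<dots> = (\<integral>\<^sup>+z. emeasure M {\<omega> \<in> space M. \<nu> i \<omega> = c \<and> X i \<omega> \<in> {x. upd z x \<in> B}} \<partial>distr M N Z)"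
      by (rule nn_integral_cong) (rule law_Y)
    finally show ?thesis .
  qed
  have sec: "{x. upd z x \<in> B} \<in> sets borel" if "z \<in> space N" for z
  proof -
    have "(\<lambda>x. upd z x) \<in> borel \<rightarrow>\<^sub>M (\<Pi>\<^sub>M i\<in>{1..m}. borel)"
      using that by (intro upd) auto
    from measurable_sets [OF this B] show ?thesis by (simp add: vimage_def)
  qed
  have meas: "(\<lambda>z. emeasure M {\<omega> \<in> space M. \<nu> i \<omega> = c \<and> X i \<omega> \<in> {x. upd z x \<in> B}})
      \<in> borel_measurable (distr M N Z)" for c
  proof -
    have "(\<lambda>z. emeasure (distr M P Y) ((\<lambda>y. (y, z)) -` D c)) \<in> borel_measurable (distr M N Z)"
      by (rule PN.measurable_emeasure_Pair2) simp
    also have "?this \<longleftrightarrow> ?thesis"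
      by (rule measurable_cong) (rule law_Y)
    finally show ?thesis .
  qed
  have "ennreal a * emeasure M {\<omega> \<in> space M. \<nu> i \<omega> = b \<and> observations m X \<omega> \<in> B} \<le>
    ennreal a' * emeasure M {\<omega> \<in> space M. \<nu> i \<omega> = (\<not> b) \<and> observations m X \<omega> \<in> B}"
    unfolding ev nn_integral_cmult [OF meas, symmetric]
  proof (rule nn_integral_mono)
    fix z assume "z \<in> space (distr M N Z)"
    then have "z \<in> space N" by simp
    moreover have "{x. upd z x \<in> B} \<subseteq> S" using BS i by (force simp: upd_def)
    ultimately show "ennreal a * emeasure M {\<omega> \<in> space M. \<nu> i \<omega> = b \<and> X i \<omega> \<in> {x. upd z x \<in> B}} \<le>
      ennreal a' * emeasure M {\<omega> \<in> space M. \<nu> i \<omega> = (\<not> b) \<and> X i \<omega> \<in> {x. upd z x \<in> B}}"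
      by (intro law sec)
  qed
  then show ?thesis
    using nonneg by (simp add: emeasure_eq_measure ennreal_mult [symmetric])
qed

lemma bayes_risk_eq_sum:
  assumes d: "\<And>i. i \<in> {1..m} \<Longrightarrow>
      {x \<in> space (\<Pi>\<^sub>M i\<in>{1..m}. borel). i \<in> d x} \<in> sets (\<Pi>\<^sub>M i\<in>{1..m}. (borel :: real measure))"
  shows "bayes_risk M m \<delta>\<^sub>0 \<delta>\<^sub>A \<nu> X d = (\<Sum>i\<in>{1..m}.
      \<delta>\<^sub>0 * \<P>(\<omega> in M. \<not> \<nu> i \<omega> \<and> i \<in> d (observations m X \<omega>)) +
      \<delta>\<^sub>A * \<P>(\<omega> in M. \<nu> i \<omega> \<and> i \<notin> d (observations m X \<omega>)))"
proof -
  have gen: "(\<integral>\<omega>. real (card {i \<in> {1..m}. Q i \<omega>}) \<partial>M) = (\<Sum>i\<in>{1..m}. \<P>(\<omega> in M. Q i \<omega>))"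
    if Q: "\<And>i. i \<in> {1..m} \<Longrightarrow> {\<omega> \<in> space M. Q i \<omega>} \<in> events" for Q :: "nat \<Rightarrow> 'a \<Rightarrow> bool"
  proof -
    have "(\<integral>\<omega>. real (card {i \<in> {1..m}. Q i \<omega>}) \<partial>M) =
        (\<integral>\<omega>. (\<Sum>i\<in>{1..m}. indicator {\<omega> \<in> space M. Q i \<omega>} \<omega>) \<partial>M)"
    proof (rule Bochner_Integration.integral_cong [OF refl])
      fix \<omega> assume "\<omega> \<in> space M"
      then have "(\<Sum>i\<in>{1..m}. indicator {\<omega> \<in> space M. Q i \<omega>} \<omega> :: real) =
          (\<Sum>i\<in>{1..m}. if Q i \<omega> then 1 else 0)"
        by (intro sum.cong) (auto simp: indicator_def)
      also have "\<dots> = real (card {i \<in> {1..m}. Q i \<omega>})"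
        by (simp add: sum.If_cases Int_def)
      finally show "real (card {i \<in> {1..m}. Q i \<omega>}) =
          (\<Sum>i\<in>{1..m}. indicator {\<omega> \<in> space M. Q i \<omega>} \<omega>)" by simp
    qed
    also have "\<dots> = (\<Sum>i\<in>{1..m}. \<P>(\<omega> in M. Q i \<omega>))"
      using Q by (subst Bochner_Integration.integral_sum) (auto simp: less_top [symmetric])
    finally show ?thesis .
  qed
  have rej [measurable]: "{\<omega> \<in> space M. i \<in> d (observations m X \<omega>)} \<in> events" if "i \<in> {1..m}" for i
  proof -
    have "{\<omega> \<in> space M. i \<in> d (observations m X \<omega>)} =
        observations m X -` {x \<in> space (\<Pi>\<^sub>M i\<in>{1..m}. borel). i \<in> d x} \<inter> space M"
      using measurable_space [OF measurable_observations] by auto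
    then show ?thesis using measurable_sets [OF measurable_observations d [OF that]] by simp
  qed
  have nu: "{\<omega> \<in> space M. \<nu> i \<omega>} \<in> events" if "i \<in> {1..m}" for i using that by measurable
  have "{\<omega> \<in> space M. \<not> \<nu> i \<omega> \<and> i \<in> d (observations m X \<omega>)} \<in> events" if "i \<in> {1..m}" for i
    using rej [OF that] nu [OF that] by (intro sets.sets_Collect_conj sets.sets_Collect_neg)
  moreover have "{\<omega> \<in> space M. \<nu> i \<omega> \<and> i \<notin> d (observations m X \<omega>)} \<in> events" if "i \<in> {1..m}" for i
    using rej [OF that] nu [OF that] by (intro sets.sets_Collect_conj sets.sets_Collect_neg)
  ultimately show ?thesis
    unfolding bayes_risk_def false_rejections_def false_acceptances_def
    by (simp only: gen sum_distrib_left sum.distrib)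
qed

theorem bayes_oracle_minimizes_risk:
  assumes cost: "0 < \<delta>\<^sub>0" "0 < \<delta>\<^sub>A"
    and d: "\<And>i. i \<in> {1..m} \<Longrightarrow>
      {x \<in> space (\<Pi>\<^sub>M i\<in>{1..m}. borel). i \<in> d x} \<in> sets (\<Pi>\<^sub>M i\<in>{1..m}. (borel :: real measure))"
  shows "optimal_risk M m p \<sigma> \<tau> \<delta>\<^sub>0 \<delta>\<^sub>A \<nu> X \<le> bayes_risk M m \<delta>\<^sub>0 \<delta>\<^sub>A \<nu> X d"
proof -
  define c where "c = bayes_oracle m p \<sigma> \<tau> \<delta>\<^sub>0 \<delta>\<^sub>A"
  define L where "L = (\<Pi>\<^sub>M i\<in>{1..m}. (borel :: real measure))"
  define S where "S = {x :: real. oracle_threshold p \<sigma> \<tau> \<delta>\<^sub>0 \<delta>\<^sub>A \<le> x\<^sup>2 / \<sigma>\<^sup>2}"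
  note thr = oracle_threshold_iff [OF p_pos p_less_1 sigma_pos tau_pos cost]
  have c_iff: "i \<in> c x \<longleftrightarrow> x i \<in> S" if "i \<in> {1..m}" for i x
    using that by (auto simp: c_def bayes_oracle_def S_def)
  have c_meas: "{x \<in> space L. i \<in> c x} \<in> sets L" if i: "i \<in> {1..m}" for i
  proof -
    have [measurable]: "(\<lambda>x. x i) \<in> borel_measurable L"
      unfolding L_def using i by (rule measurable_component_singleton)
    have "{x \<in> space L. i \<in> c x} = {x \<in> space L. oracle_threshold p \<sigma> \<tau> \<delta>\<^sub>0 \<delta>\<^sub>A \<le> (x i)\<^sup>2 / \<sigma>\<^sup>2}"
      using c_iff [OF i] by (auto simp: S_def)
    also have "\<dots> \<in> sets L" by measurable
    finally show ?thesis .
  qed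
  have obs: "observations m X \<omega> \<in> space L" if "\<omega> \<in> space M" for \<omega>
    using measurable_space [OF measurable_observations that] by (simp add: L_def)
  have joint: "ennreal \<delta>\<^sub>0 * emeasure M {\<omega> \<in> space M. \<not> \<nu> i \<omega> \<and> X i \<omega> \<in> A} =
      (\<integral>\<^sup>+x\<in>A. ennreal (\<delta>\<^sub>0 * ((1 - p) * normal_density 0 \<sigma> x)) \<partial>lborel)"
    "ennreal \<delta>\<^sub>A * emeasure M {\<omega> \<in> space M. \<nu> i \<omega> \<and> X i \<omega> \<in> A} =
      (\<integral>\<^sup>+x\<in>A. ennreal (\<delta>\<^sub>A * (p * normal_density 0 (sqrt (\<sigma>\<^sup>2 + \<tau>\<^sup>2)) x)) \<partial>lborel)"
    if i: "i \<in> {1..m}" and A: "A \<in> sets borel" for i A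
    unfolding joint_law [OF i A] using cost A
    by (subst nn_integral_cmult [symmetric]; simp add: ennreal_mult' mult.assoc)+
  have "(\<delta>\<^sub>0 * \<P>(\<omega> in M. \<not> \<nu> i \<omega> \<and> i \<in> c (observations m X \<omega>)) +
      \<delta>\<^sub>A * \<P>(\<omega> in M. \<nu> i \<omega> \<and> i \<notin> c (observations m X \<omega>))) \<le>
     (\<delta>\<^sub>0 * \<P>(\<omega> in M. \<not> \<nu> i \<omega> \<and> i \<in> d (observations m X \<omega>)) +
      \<delta>\<^sub>A * \<P>(\<omega> in M. \<nu> i \<omega> \<and> i \<notin> d (observations m X \<omega>)))" if i: "i \<in> {1..m}" for i
  proof -
    define B1 where "B1 = {x \<in> space L. i \<in> c x \<and> i \<notin> d x}"
    define B2 where "B2 = {x \<in> space L. i \<notin> c x \<and> i \<in> d x}"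
    define B3 where "B3 = {x \<in> space L. i \<in> c x \<and> i \<in> d x}"
    define B4 where "B4 = {x \<in> space L. i \<notin> c x \<and> i \<notin> d x}"
    have dm: "{x \<in> space L. i \<in> d x} \<in> sets L" using d [OF i] by (simp add: L_def)
    have B: "B1 \<in> sets L" "B2 \<in> sets L" "B3 \<in> sets L" "B4 \<in> sets L"
      unfolding B1_def B2_def B3_def B4_def using dm c_meas [OF i]
      by (auto intro!: sets.sets_Collect_conj sets.sets_Collect_neg)
    define E where "E b B = {\<omega> \<in> space M. \<nu> i \<omega> = b \<and> observations m X \<omega> \<in> B}" for b B
    have E: "E b B \<in> events" if "B \<in> sets L" for b B
    proof -
      have [measurable]: "\<nu> i \<in> M \<rightarrow>\<^sub>M count_space UNIV" by (rule measurable_nu [OF i])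
      have [measurable]: "observations m X \<in> M \<rightarrow>\<^sub>M L" unfolding L_def by (rule measurable_observations)
      note that [measurable]
      show ?thesis unfolding E_def by measurable
    qed
    have split: "prob (E b (A \<union> A')) = prob (E b A) + prob (E b A')"
      if "A \<in> sets L" "A' \<in> sets L" "A \<inter> A' = {}" for b A A'
    proof -
      have "E b (A \<union> A') = E b A \<union> E b A'" by (auto simp: E_def)
      moreover have "E b A \<inter> E b A' = {}" using that by (auto simp: E_def)
      ultimately show ?thesis using E that by (simp add: finite_measure_Union)
    qed
    have eqs: "{\<omega> \<in> space M. \<not> \<nu> i \<omega> \<and> i \<in> c (observations m X \<omega>)} = E False (B1 \<union> B3)"
        "{\<omega> \<in> space M. \<not> \<nu> i \<omega> \<and> i \<in> d (observations m X \<omega>)} = E False (B2 \<union> B3)"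
        "{\<omega> \<in> space M. \<nu> i \<omega> \<and> i \<notin> c (observations m X \<omega>)} = E True (B2 \<union> B4)"
        "{\<omega> \<in> space M. \<nu> i \<omega> \<and> i \<notin> d (observations m X \<omega>)} = E True (B1 \<union> B4)"
      using obs by (auto simp: E_def B1_def B2_def B3_def B4_def)
    have 1: "\<delta>\<^sub>0 * prob (E False B1) \<le> \<delta>\<^sub>A * prob (E True B1)"
    proof -
      have "\<delta>\<^sub>0 * \<P>(\<omega> in M. \<nu> i \<omega> = False \<and> observations m X \<omega> \<in> B1) \<le>
          \<delta>\<^sub>A * \<P>(\<omega> in M. \<nu> i \<omega> = (\<not> False) \<and> observations m X \<omega> \<in> B1)"
      proof (rule compare_events [OF i B(1) [unfolded L_def], where S = "S"])
      show "x i \<in> S" if "x \<in> B1" for x using that c_iff [OF i] by (auto simp: B1_def)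
      show "0 \<le> \<delta>\<^sub>0" "0 \<le> \<delta>\<^sub>A" using cost by auto
      show "ennreal \<delta>\<^sub>0 * emeasure M {\<omega> \<in> space M. \<nu> i \<omega> = False \<and> X i \<omega> \<in> A} \<le>
         ennreal \<delta>\<^sub>A * emeasure M {\<omega> \<in> space M. \<nu> i \<omega> = (\<not> False) \<and> X i \<omega> \<in> A}"
        if A: "A \<in> sets borel" "A \<subseteq> S" for A
        using A(2) unfolding not_True_eq_False not_False_eq_True eq_True eq_False joint [OF i A(1)]
        by (intro nn_integral_mono)
          (auto simp: S_def thr indicator_def intro!: ennreal_leI)
      qed
      then show ?thesis by (simp add: E_def)
    qed
    have 2: "\<delta>\<^sub>A * prob (E True B2) \<le> \<delta>\<^sub>0 * prob (E False B2)"
    proof -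
      have "\<delta>\<^sub>A * \<P>(\<omega> in M. \<nu> i \<omega> = True \<and> observations m X \<omega> \<in> B2) \<le>
          \<delta>\<^sub>0 * \<P>(\<omega> in M. \<nu> i \<omega> = (\<not> True) \<and> observations m X \<omega> \<in> B2)"
      proof (rule compare_events [OF i B(2) [unfolded L_def], where S = "- S"])
      show "x i \<in> - S" if "x \<in> B2" for x using that c_iff [OF i] by (auto simp: B2_def)
      show "0 \<le> \<delta>\<^sub>0" "0 \<le> \<delta>\<^sub>A" using cost by auto
      show "ennreal \<delta>\<^sub>A * emeasure M {\<omega> \<in> space M. \<nu> i \<omega> = True \<and> X i \<omega> \<in> A} \<le>
         ennreal \<delta>\<^sub>0 * emeasure M {\<omega> \<in> space M. \<nu> i \<omega> = (\<not> True) \<and> X i \<omega> \<in> A}"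
        if A: "A \<in> sets borel" "A \<subseteq> - S" for A
        using A(2) unfolding not_True_eq_False not_False_eq_True eq_True eq_False joint [OF i A(1)]
        by (intro nn_integral_mono)
          (auto simp: S_def thr indicator_def intro!: ennreal_leI)
      qed
      then show ?thesis by (simp add: E_def)
    qed
    have disj: "B1 \<inter> B3 = {}" "B2 \<inter> B3 = {}" "B2 \<inter> B4 = {}" "B1 \<inter> B4 = {}"
      by (auto simp: B1_def B2_def B3_def B4_def)
    show ?thesis
      unfolding eqs using 1 2 B disj by (simp add: split distrib_left)
  qed
  moreover have "bayes_risk M m \<delta>\<^sub>0 \<delta>\<^sub>A \<nu> X d = (\<Sum>i\<in>{1..m}.
      \<delta>\<^sub>0 * \<P>(\<omega> in M. \<not> \<nu> i \<omega> \<and> i \<in> d (observations m X \<omega>)) +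
      \<delta>\<^sub>A * \<P>(\<omega> in M. \<nu> i \<omega> \<and> i \<notin> d (observations m X \<omega>)))"
    by (rule bayes_risk_eq_sum) (rule d)
  moreover have "bayes_risk M m \<delta>\<^sub>0 \<delta>\<^sub>A \<nu> X c = (\<Sum>i\<in>{1..m}.
      \<delta>\<^sub>0 * \<P>(\<omega> in M. \<not> \<nu> i \<omega> \<and> i \<in> c (observations m X \<omega>)) +
      \<delta>\<^sub>A * \<P>(\<omega> in M. \<nu> i \<omega> \<and> i \<notin> c (observations m X \<omega>)))"
    by (rule bayes_risk_eq_sum) (rule c_meas [unfolded L_def])
  ultimately show ?thesis
    unfolding optimal_risk_def c_def [symmetric] by (simp only: sum_mono)
qed

end

end

theory Submission
  imports Defs
begin

text \<open>
  Let \<open>G\<close> be the mass that the standard normal law gives to the interval from \<open>- sqrt C\<close> to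
  \<open>sqrt C\<close>. Both risks are asymptotic to \<open>\<delta>\<^sub>A m p G\<close>, the cost of the type II errors of a
  test that rejects when \<open>X\<^sup>2 / \<sigma>\<^sup>2\<close> exceeds a threshold asymptotic to \<open>C u\<close>.
  As the oracle minimizes the risk, it suffices to bound its risk from below and that of the
  Benjamini--Hochberg procedure from above. The lower bound (\<open>optimal_risk_ge\<close>) counts only the
  type II errors of the oracle.

  The upper bound rests on a leave-one-out property (\<open>bh_count_insert_iff\<close>): whether hypothesis
  \<open>i\<close> is rejected can be decided by comparing its p-value with \<open>K \<alpha> / m\<close>, where \<open>K\<close> is the
  number of rejections after this p-value has been replaced by \<open>0\<close>. This \<open>K\<close> is independent of
  test \<open>i\<close> (\<open>rejections_indep\<close>).

  For the type I errors, the property shows that a given null hypothesis is falsely rejected with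
  probability at most \<open>\<alpha> / m\<close> times the expectation of \<open>K\<close>. Splitting the rejections counted by
  \<open>K\<close> into true and false ones leads to the same quantity with one more p-value set to \<open>0\<close>; solving
  the recursion gives at most \<open>r (m p + 1 / (1 - \<alpha>))\<close> false rejections on average
  (\<open>sum_false_rejection_le\<close>). Relative to \<open>\<delta>\<^sub>A m p\<close> their cost is of order \<open>\<delta> r\<close>, because
  \<open>m p\<close> stays away from \<open>0\<close> and \<open>\<alpha>\<close> away from \<open>1\<close>; and \<open>\<delta> r\<close> tends to \<open>0\<close> by the
  assumptions that relate the level to \<open>\<delta>\<close> and \<open>u\<close> (\<open>level_asymptotics\<close>).

  For the type II errors, if at least \<open>k\<close> hypotheses are rejected then only observations with
  p-value above \<open>k \<alpha> / m\<close> are accepted, which by the Gaussian tail bound happens only if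
  \<open>\<bar>X\<bar> / \<sigma>\<close> is less than \<open>sqrt (2 ln (2 m / (k \<alpha>)))\<close> (\<open>false_acceptance_le\<close>). With \<open>k\<close> of the order of
  \<open>m p\<close>, the square of this threshold is \<open>2 ln (f / r)\<close> up to a bounded term, hence asymptotic to
  \<open>C u\<close> by the same assumptions. If \<open>m p\<close> is bounded, \<open>k = 1\<close> will do. If \<open>m p\<close> tends to infinity, a
  positive fraction of the roughly \<open>m p\<close> true effects exceeds this threshold, so that by
  Chebyshev's inequality at least \<open>k\<close> hypotheses are rejected with probability tending to \<open>1\<close>
  (\<open>few_rejections_le\<close>).
\<close>

section \<open>The normal law\<close>

lemma prob_space_std_normal: "prob_space std_normal_distribution"
  by (rule prob_space_normal_density) simp

lemma measure_centred_normal: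
  assumes s: "0 < s" and A: "A \<in> sets borel"
  shows "measure (centred_normal s) A = measure std_normal_distribution {y. s * y \<in> A}"
proof -
  interpret prob_space std_normal_distribution by (rule prob_space_std_normal)
  have "distributed std_normal_distribution lborel (\<lambda>y. y) std_normal_density"
    unfolding distributed_def by (auto intro!: measure_eqI simp: emeasure_distr)
  from normal_density_affine [OF this, of s 0]
  have "distributed std_normal_distribution lborel (\<lambda>y. s * y) (normal_density 0 s)"
    using s by simp
  then have "distr std_normal_distribution lborel (\<lambda>y. s * y) = centred_normal s"
    by (simp add: distributed_def centred_normal_def)
  then have "measure (centred_normal s) A = measure (distr std_normal_distribution lborel (\<lambda>y. s * y)) A"
    by simp
  also have "\<dots> = measure std_normal_distribution {y. s * y \<in> A}"
    using A by (subst measure_distr) (auto simp: vimage_def)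
  finally show ?thesis .
qed

lemma measure_std_normal_uminus:
  assumes A: "A \<in> sets borel"
  shows "measure std_normal_distribution {y. - y \<in> A} = measure std_normal_distribution A"
proof -
  interpret prob_space std_normal_distribution by (rule prob_space_std_normal)
  have "distributed std_normal_distribution lborel (\<lambda>y. y) std_normal_density"
    unfolding distributed_def by (auto intro!: measure_eqI simp: emeasure_distr)
  from normal_density_affine [OF this, of "-1" 0]
  have "distr std_normal_distribution lborel (\<lambda>y. - y) = std_normal_distribution"
    by (simp add: distributed_def)
  then have "measure std_normal_distribution A = measure (distr std_normal_distribution lborel (\<lambda>y. - y)) A"
    by simp
  also have "\<dots> = measure std_normal_distribution {y. - y \<in> A}"
    using A by (subst measure_distr) (auto simp: vimage_def)
  finally show ?thesis by simp
qed

lemma measure_std_normal_pos: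
  fixes a b :: real
  assumes "a < b"
  shows "0 < measure std_normal_distribution {a<..<b}"
proof -
  interpret prob_space std_normal_distribution by (rule prob_space_std_normal)
  have "emeasure std_normal_distribution {a<..<b} \<noteq> 0"
  proof
    assume "emeasure std_normal_distribution {a<..<b} = 0"
    then have "{a<..<b} \<in> null_sets std_normal_distribution" by auto
    then have "AE x in lborel. x \<in> {a<..<b} \<longrightarrow> ennreal (std_normal_density x) = 0"
      by (subst (asm) null_sets_density_iff) auto
    then have "AE x in lborel. x \<notin> {a<..<b}"
      by eventually_elim (metis ennreal_eq_0_iff less_irrefl normal_density_pos not_le zero_less_one)
    then have "{a<..<b} \<in> null_sets lborel" by (simp add: AE_iff_null_sets)
    with assms show False by (auto simp: null_sets_def)
  qed
  then show ?thesis by (simp add: emeasure_eq_measure zero_less_measure_iff)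
qed

lemma measure_std_normal_singleton: "measure std_normal_distribution {x} = 0"
proof -
  have "AE y in lborel. y \<in> {x} \<longrightarrow> ennreal (std_normal_density y) = 0"
    using AE_lborel_singleton [of x] by eventually_elim simp
  then have "{x} \<in> null_sets std_normal_distribution"
    by (subst null_sets_density_iff) auto
  then show ?thesis by (auto simp: measure_def)
qed

lemma isCont_cdf_std_normal: "isCont (cdf std_normal_distribution) x"
  by (simp add: real_distribution.finite_borel_measure_M finite_borel_measure.isCont_cdf
      real_dist_normal_dist measure_std_normal_singleton)

text \<open>On \<open>[c, \<infinity>)\<close> the standard normal density is at most \<open>exp (- c\<^sup>2 / 2)\<close> times the density shifted by \<open>c\<close>.\<close>

lemma std_normal_upper_tail:
  assumes c: "0 \<le> c"
  shows "measure std_normal_distribution {c..} \<le> exp (- c\<^sup>2 / 2)"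
proof -
  interpret prob_space std_normal_distribution by (rule prob_space_std_normal)
  have N: "(\<integral>\<^sup>+x. ennreal (normal_density c 1 x) \<partial>lborel) = 1"
    using prob_space.emeasure_space_1 [OF prob_space_normal_density [of 1 c]]
    by (simp add: emeasure_density)
  have "emeasure std_normal_distribution {c..} = (\<integral>\<^sup>+x\<in>{c..}. ennreal (std_normal_density x) \<partial>lborel)"
    by (subst emeasure_density) auto
  also have "\<dots> \<le> (\<integral>\<^sup>+x. ennreal (exp (- c\<^sup>2 / 2)) * ennreal (normal_density c 1 x) \<partial>lborel)"
  proof (rule nn_integral_mono)
    fix x :: real
    have "std_normal_density x \<le> exp (- c\<^sup>2 / 2) * normal_density c 1 x" if "c \<le> x"
    proof -
      have "0 \<le> c * (x - c)" using that c by simp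
      then have "- x\<^sup>2 / 2 \<le> - c\<^sup>2 / 2 + (- (x - c)\<^sup>2 / 2)"
        by (simp add: power2_eq_square algebra_simps)
      then have "exp (- x\<^sup>2 / 2) \<le> exp (- c\<^sup>2 / 2) * exp (- (x - c)\<^sup>2 / 2)"
        by (simp flip: exp_add)
      from divide_right_mono [OF this, of "sqrt (2 * pi)"] show ?thesis
        by (simp add: normal_density_def)
    qed
    then show "ennreal (std_normal_density x) * indicator {c..} x \<le>
        ennreal (exp (- c\<^sup>2 / 2)) * ennreal (normal_density c 1 x)"
      by (auto simp: indicator_def ennreal_mult' [symmetric] intro!: ennreal_leI)
  qed
  also have "\<dots> = ennreal (exp (- c\<^sup>2 / 2))"
    by (subst nn_integral_cmult) (auto simp: N)
  finally show ?thesis by (simp add: emeasure_eq_measure)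
qed

text \<open>The mass that the standard normal law gives to the open interval from \<open>- x\<close> to \<open>x\<close>.\<close>

definition central_mass :: "real \<Rightarrow> real" where
  "central_mass x = measure std_normal_distribution {y. \<bar>y\<bar> < x}"

lemma central_mass_eq_cdf:
  assumes "0 \<le> x"
  shows "central_mass x = 2 * cdf std_normal_distribution x - 1"
proof -
  interpret prob_space std_normal_distribution by (rule prob_space_std_normal)
  have "prob {..- x} = prob {y. - y \<in> {x..}}"
    by (rule arg_cong [where f = prob]) auto
  also have "\<dots> = prob {x..}" by (rule measure_std_normal_uminus) simp
  also have "\<dots> = prob ({x} \<union> {x<..})" by (rule arg_cong [where f = prob]) auto
  also have "\<dots> = prob {x<..}"
    by (subst finite_measure_Union) (auto simp: measure_std_normal_singleton)
  also have "\<dots> = prob (space std_normal_distribution - {..x})"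
    by (rule arg_cong [where f = prob]) auto
  also have "\<dots> = 1 - prob {..x}" by (rule prob_compl) simp
  finally have lower: "prob {..- x} = 1 - prob {..x}" .
  have "prob {..x} = prob ({..- x} \<union> ({y. \<bar>y\<bar> < x} \<union> ({x} - {-x})))"
    using assms by (intro arg_cong [where f = prob]) auto
  also have "\<dots> = prob {..- x} + prob ({y. \<bar>y\<bar> < x} \<union> ({x} - {-x}))"
    using assms by (intro finite_measure_Union) auto
  also have "prob ({y. \<bar>y\<bar> < x} \<union> ({x} - {-x})) = prob {y. \<bar>y\<bar> < x} + prob ({x} - {- x})"
    by (rule finite_measure_Union) auto
  also have "prob ({x} - {- x}) = 0"
    using finite_measure_mono [of "{x} - {- x}" "{x}"]
    by (simp add: measure_std_normal_singleton order_antisym)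
  finally show ?thesis using lower by (simp add: central_mass_def cdf_def)
qed

lemma central_mass_pos: "0 < x \<Longrightarrow> 0 < central_mass x"
proof -
  assume "0 < x"
  moreover have "{y. \<bar>y\<bar> < x} = {- x<..<x}" by auto
  ultimately show ?thesis by (simp add: central_mass_def measure_std_normal_pos)
qed

lemma central_mass_less_1: "central_mass x < 1"
proof -
  interpret prob_space std_normal_distribution by (rule prob_space_std_normal)
  have "0 < prob {\<bar>x\<bar><..<\<bar>x\<bar> + 1}" by (rule measure_std_normal_pos) simp
  also have "\<dots> \<le> prob (space std_normal_distribution - {y. \<bar>y\<bar> < x})"
    by (rule finite_measure_mono) auto
  also have "\<dots> = 1 - central_mass x" unfolding central_mass_def by (rule prob_compl) simp
  finally show ?thesis by simp
qed

lemma tendsto_central_mass: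
  assumes g: "(g \<longlongrightarrow> x) F" and x: "0 < x"
  shows "((\<lambda>z. central_mass (g z)) \<longlongrightarrow> central_mass x) F"
proof -
  have "((\<lambda>z. 2 * cdf std_normal_distribution (g z) - 1) \<longlongrightarrow> 2 * cdf std_normal_distribution x - 1) F"
    by (intro tendsto_intros isCont_tendsto_compose [OF isCont_cdf_std_normal] g)
  moreover have "\<forall>\<^sub>F z in F. 2 * cdf std_normal_distribution (g z) - 1 = central_mass (g z)"
    using order_tendstoD(1) [OF g x] by eventually_elim (simp add: central_mass_eq_cdf)
  ultimately show ?thesis
    using x by (simp add: central_mass_eq_cdf tendsto_cong)
qed

lemma p_value_eq: "0 < \<sigma> \<Longrightarrow> p_value \<sigma> x = 1 - central_mass (\<bar>x\<bar> / \<sigma>)"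
  by (simp add: p_value_def central_mass_eq_cdf)

lemma p_value_measurable [measurable]: "p_value \<sigma> \<in> borel_measurable borel"
proof -
  have "cdf std_normal_distribution \<in> borel_measurable borel"
    by (intro borel_measurable_continuous_onI continuous_at_imp_continuous_on ballI isCont_cdf_std_normal)
  note [measurable] = this
  show ?thesis unfolding p_value_def by measurable
qed

lemma p_value_le_exp:
  assumes s: "0 < \<sigma>" and c: "0 \<le> c" "c * \<sigma> \<le> \<bar>x\<bar>"
  shows "p_value \<sigma> x \<le> 2 * exp (- c\<^sup>2 / 2)"
proof -
  interpret prob_space std_normal_distribution by (rule prob_space_std_normal)
  define z where "z = \<bar>x\<bar> / \<sigma>"
  have z: "c \<le> z" using s c by (simp add: z_def field_simps)
  have "1 - cdf std_normal_distribution z = prob (space std_normal_distribution - {..z})"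
    unfolding cdf_def by (subst prob_compl) auto
  also have "\<dots> \<le> prob {c..}"
    using z by (intro finite_measure_mono) auto
  also have "\<dots> \<le> exp (- c\<^sup>2 / 2)" by (rule std_normal_upper_tail) fact
  finally show ?thesis by (simp add: p_value_def z_def)
qed

text \<open>Under the null hypothesis the p-value is stochastically at least uniform.\<close>

lemma measure_p_value_le:
  assumes s: "0 < \<sigma>" and t: "0 < t"
  shows "measure (centred_normal \<sigma>) {x. p_value \<sigma> x \<le> t} \<le> t"
proof (cases "1 \<le> t")
  case True
  interpret prob_space "centred_normal \<sigma>"
    unfolding centred_normal_def using s by (rule prob_space_normal_density)
  show ?thesis using True prob_le_1 [of "{x. p_value \<sigma> x \<le> t}"] by linarith
next
  case False
  interpret N: real_distribution std_normal_distribution by (rule real_dist_normal_dist)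
  have "\<exists>c\<ge>0. 1 - central_mass c = t"
  proof -
    have "\<forall>\<^sub>F y in at_top. 1 - t / 2 < cdf std_normal_distribution y \<and> 0 \<le> y"
      using order_tendstoD(1) [OF N.cdf_lim_at_top_prob, of "1 - t / 2"] t eventually_ge_at_top [of 0]
      by (auto simp: eventually_conj_iff)
    then obtain b where b: "1 - t / 2 < cdf std_normal_distribution b" "0 \<le> b"
      by (auto simp: eventually_at_top_linorder)
    have "central_mass 0 = 0" by (simp add: central_mass_def)
    then have "cdf std_normal_distribution 0 = 1 / 2" by (simp add: central_mass_eq_cdf)
    with False have "\<exists>c. 0 \<le> c \<and> c \<le> b \<and> cdf std_normal_distribution c = 1 - t / 2"
      using b by (intro IVT) (auto simp: isCont_cdf_std_normal)
    then show ?thesis by (auto simp: central_mass_eq_cdf)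
  qed
  then obtain c where c: "0 \<le> c" "1 - central_mass c = t" by blast
  \<comment> \<open>if \<open>central_mass\<close> were constant to the left of \<open>c\<close>, then \<open>p_value \<sigma> x \<le> t\<close> would not force \<open>c \<sigma> \<le> \<bar>x\<bar>\<close>\<close>
  have strict: "central_mass a < central_mass c" if "a < c" "0 \<le> a" for a
  proof -
    have "N.prob {y. \<bar>y\<bar> < a} + N.prob {a<..<c} = N.prob ({y. \<bar>y\<bar> < a} \<union> {a<..<c})"
      by (rule N.finite_measure_Union [symmetric]) auto
    also have "\<dots> \<le> central_mass c"
      unfolding central_mass_def using that by (intro N.finite_measure_mono) auto
    finally show ?thesis using measure_std_normal_pos [OF that(1)] by (simp add: central_mass_def)
  qed
  have "{x. p_value \<sigma> x \<le> t} \<in> sets borel" by measurable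
  with s have "measure (centred_normal \<sigma>) {x. p_value \<sigma> x \<le> t} =
      N.prob {y. \<sigma> * y \<in> {x. p_value \<sigma> x \<le> t}}"
    by (rule measure_centred_normal)
  also have "{y. \<sigma> * y \<in> {x. p_value \<sigma> x \<le> t}} = {y. 1 - central_mass \<bar>y\<bar> \<le> t}"
    using s by (simp add: p_value_eq abs_mult)
  also have "\<dots> \<subseteq> space std_normal_distribution - {y. \<bar>y\<bar> < c}"
    using strict c by fastforce
  then have "N.prob {y. 1 - central_mass \<bar>y\<bar> \<le> t} \<le> N.prob (space std_normal_distribution - {y. \<bar>y\<bar> < c})"
    by (intro N.finite_measure_mono) auto
  also have "\<dots> = 1 - central_mass c"
    unfolding central_mass_def by (rule N.prob_compl) simp
  finally show ?thesis using c by simp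
qed

lemma measure_centred_normal_central:
  assumes s: "0 < s"
  shows "measure (centred_normal s) {x. \<bar>x\<bar> < c} = central_mass (c / s)"
  using s by (subst measure_centred_normal) (auto simp: central_mass_def abs_mult field_simps)


section \<open>Counting form of the Benjamini--Hochberg procedure\<close>

text \<open>
  The number \<open>k\<close> of rejections of the Benjamini--Hochberg procedure at level \<open>\<alpha>\<close> for the p-values
  \<open>q 1, \<dots>, q m\<close> after the p-values with index in \<open>A \<subseteq> {1..m}\<close> have been replaced by \<open>0\<close>. It is
  the largest \<open>k \<le> m\<close> for which at least \<open>k\<close> of the p-values are at most \<open>k \<alpha> / m\<close>, where
  \<open>k = 0\<close> always qualifies.
\<close>

definition bh_count :: "nat \<Rightarrow> real \<Rightarrow> nat set \<Rightarrow> (nat \<Rightarrow> real) \<Rightarrow> nat" where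
  "bh_count m \<alpha> A q =
     Max {k \<in> {0..m}. k \<le> card {i \<in> {1..m}. i \<in> A \<or> q i \<le> real k * \<alpha> / real m}}"

lemma bh_count_le: "bh_count m \<alpha> A q \<le> m"
  and bh_count_le_card:
    "bh_count m \<alpha> A q \<le> card {i \<in> {1..m}. i \<in> A \<or> q i \<le> real (bh_count m \<alpha> A q) * \<alpha> / real m}"
proof -
  let ?K = "{k \<in> {0..m}. k \<le> card {i \<in> {1..m}. i \<in> A \<or> q i \<le> real k * \<alpha> / real m}}"
  have "bh_count m \<alpha> A q \<in> ?K" unfolding bh_count_def
  proof (rule Max_in)
    show "?K \<noteq> {}" by (force intro: exI [of _ 0])
  qed simp
  then show "bh_count m \<alpha> A q \<le> m"
    "bh_count m \<alpha> A q \<le> card {i \<in> {1..m}. i \<in> A \<or> q i \<le> real (bh_count m \<alpha> A q) * \<alpha> / real m}"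
    by auto
qed

lemma bh_count_greatest:
  assumes "k \<le> m" "k \<le> card {i \<in> {1..m}. i \<in> A \<or> q i \<le> real k * \<alpha> / real m}"
  shows "k \<le> bh_count m \<alpha> A q"
  unfolding bh_count_def using assms by (intro Max_ge) auto

lemma bh_count_pos:
  assumes "i \<in> {1..m}" "i \<in> A"
  shows "1 \<le> bh_count m \<alpha> A q"
proof (rule bh_count_greatest)
  show "1 \<le> card {j \<in> {1..m}. j \<in> A \<or> q j \<le> real 1 * \<alpha> / real m}"
    using assms by (simp add: Suc_le_eq card_gt_0_iff) auto
qed (use assms in auto)

text \<open>
  Whether the \<open>i\<close>-th hypothesis is rejected can be decided by comparing its p-value with a
  threshold that does not depend on this p-value.
\<close>

lemma bh_count_insert_iff:
  assumes \<alpha>: "0 \<le> \<alpha>" and m: "0 < m"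
  shows "q i \<le> real (bh_count m \<alpha> A q) * \<alpha> / real m \<longleftrightarrow>
    q i \<le> real (bh_count m \<alpha> (insert i A) q) * \<alpha> / real m"
proof
  assume le: "q i \<le> real (bh_count m \<alpha> A q) * \<alpha> / real m"
  have "bh_count m \<alpha> A q \<le> bh_count m \<alpha> (insert i A) q"
  proof (rule bh_count_greatest [OF bh_count_le])
    have "{j \<in> {1..m}. j \<in> A \<or> q j \<le> real (bh_count m \<alpha> A q) * \<alpha> / real m} \<subseteq>
        {j \<in> {1..m}. j \<in> insert i A \<or> q j \<le> real (bh_count m \<alpha> A q) * \<alpha> / real m}" by auto
    then show "bh_count m \<alpha> A q \<le>
        card {j \<in> {1..m}. j \<in> insert i A \<or> q j \<le> real (bh_count m \<alpha> A q) * \<alpha> / real m}"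
      by (intro order_trans [OF bh_count_le_card] card_mono) auto
  qed
  then show "q i \<le> real (bh_count m \<alpha> (insert i A) q) * \<alpha> / real m"
    using \<alpha> m by (intro order_trans [OF le] divide_right_mono mult_right_mono) auto
next
  let ?k = "bh_count m \<alpha> (insert i A) q"
  assume le: "q i \<le> real ?k * \<alpha> / real m"
  have "?k \<le> bh_count m \<alpha> A q"
  proof (rule bh_count_greatest [OF bh_count_le])
    have "{j \<in> {1..m}. j \<in> insert i A \<or> q j \<le> real ?k * \<alpha> / real m} =
        {j \<in> {1..m}. j \<in> A \<or> q j \<le> real ?k * \<alpha> / real m}" using le by auto
    with bh_count_le_card [of m \<alpha> "insert i A" q]
    show "?k \<le> card {j \<in> {1..m}. j \<in> A \<or> q j \<le> real ?k * \<alpha> / real m}" by simp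
  qed
  then show "q i \<le> real (bh_count m \<alpha> A q) * \<alpha> / real m"
    using \<alpha> m by (intro order_trans [OF le] divide_right_mono mult_right_mono) auto
qed

lemma bh_count_cong:
  assumes "\<And>i. i \<in> {1..m} \<Longrightarrow> i \<notin> A \<Longrightarrow> q i = q' i"
  shows "bh_count m \<alpha> A q = bh_count m \<alpha> A q'"
proof -
  have "{i \<in> {1..m}. i \<in> A \<or> q i \<le> t} = {i \<in> {1..m}. i \<in> A \<or> q' i \<le> t}" for t
  proof (rule Collect_cong)
    fix i
    show "i \<in> {1..m} \<and> (i \<in> A \<or> q i \<le> t) \<longleftrightarrow> i \<in> {1..m} \<and> (i \<in> A \<or> q' i \<le> t)"
      using assms [of i] by (cases "i \<in> A") auto
  qed
  then show ?thesis by (simp add: bh_count_def)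
qed

lemma sorted_nth_le_iff:
  fixes ys :: "'a :: linorder list"
  assumes "sorted ys" "k \<in> {1..length ys}"
  shows "ys ! (k - 1) \<le> t \<longleftrightarrow> k \<le> card {i. i < length ys \<and> ys ! i \<le> t}"
proof
  assume le: "ys ! (k - 1) \<le> t"
  have "{..<k} \<subseteq> {i. i < length ys \<and> ys ! i \<le> t}"
  proof
    fix i assume i: "i \<in> {..<k}"
    then have "ys ! i \<le> ys ! (k - 1)" using assms by (intro sorted_nth_mono) auto
    with i le show "i \<in> {i. i < length ys \<and> ys ! i \<le> t}" using assms by auto
  qed
  then have "card {..<k} \<le> card {i. i < length ys \<and> ys ! i \<le> t}" by (rule card_mono [rotated]) simp
  then show "k \<le> card {i. i < length ys \<and> ys ! i \<le> t}" by simp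
next
  assume k: "k \<le> card {i. i < length ys \<and> ys ! i \<le> t}"
  show "ys ! (k - 1) \<le> t"
  proof (rule ccontr)
    assume gt: "\<not> ys ! (k - 1) \<le> t"
    have "{i. i < length ys \<and> ys ! i \<le> t} \<subseteq> {..<k - 1}"
    proof
      fix i assume i: "i \<in> {i. i < length ys \<and> ys ! i \<le> t}"
      show "i \<in> {..<k - 1}"
      proof (rule ccontr)
        assume "i \<notin> {..<k - 1}"
        then have "ys ! (k - 1) \<le> ys ! i" using assms i by (intro sorted_nth_mono) auto
        with i gt show False by auto
      qed
    qed
    then have "card {i. i < length ys \<and> ys ! i \<le> t} \<le> card {..<k - 1}" by (rule card_mono [rotated]) simp
    with k assms show False by (simp, linarith)
  qed
qed

lemma ordered_p_value_le_iff:
  assumes k: "k \<in> {1..m}"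
  shows "ordered_p_value m \<sigma> x k \<le> t \<longleftrightarrow> k \<le> card {i \<in> {1..m}. p_value \<sigma> (x i) \<le> t}"
proof -
  define xs where "xs = map (\<lambda>j. p_value \<sigma> (x j)) [1..<Suc m]"
  have "ordered_p_value m \<sigma> x k \<le> t \<longleftrightarrow> k \<le> card {i. i < length (sort xs) \<and> sort xs ! i \<le> t}"
    unfolding ordered_p_value_def xs_def [symmetric]
    using k by (intro sorted_nth_le_iff) (auto simp: xs_def)
  also have "card {i. i < length (sort xs) \<and> sort xs ! i \<le> t} = length (filter (\<lambda>y. y \<le> t) (sort xs))"
    by (simp only: length_filter_conv_card)
  also have "\<dots> = size (filter_mset (\<lambda>y. y \<le> t) (mset xs))"
    by (metis mset_filter mset_sort size_mset)
  also have "\<dots> = length (filter (\<lambda>j. p_value \<sigma> (x j) \<le> t) [1..<Suc m])"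
    by (simp only: xs_def filter_map length_map comp_def size_mset flip: mset_filter)
  also have "\<dots> = card {i \<in> {1..m}. p_value \<sigma> (x i) \<le> t}"
    by (subst distinct_card [symmetric])
       (auto simp del: upt_Suc intro!: arg_cong [where f = card])
  finally show ?thesis .
qed

lemma benjamini_hochberg_iff:
  assumes \<alpha>: "0 \<le> \<alpha>" and i: "i \<in> {1..m}"
  shows "i \<in> benjamini_hochberg m \<sigma> \<alpha> x \<longleftrightarrow>
    p_value \<sigma> (x i) \<le> real (bh_count m \<alpha> {} (\<lambda>j. p_value \<sigma> (x j))) * \<alpha> / real m"
proof -
  define q where "q j = p_value \<sigma> (x j)" for j
  define n where "n = bh_count m \<alpha> {} q"
  define K where "K = {k \<in> {1..m}. ordered_p_value m \<sigma> x k \<le> real k * \<alpha> / real m}"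
  have K_iff: "k \<in> K \<longleftrightarrow> k \<in> {1..m} \<and> k \<le> card {j \<in> {1..m}. q j \<le> real k * \<alpha> / real m}" for k
    using ordered_p_value_le_iff [of k m \<sigma> x] by (auto simp: K_def q_def)
  have n_ge: "k \<le> n" if "k \<in> K" for k
    using that unfolding n_def K_iff by (intro bh_count_greatest) auto
  have n_card: "n \<le> card {j \<in> {1..m}. q j \<le> real n * \<alpha> / real m}"
    unfolding n_def using bh_count_le_card [of m \<alpha> "{}" q] by simp
  have "n \<le> m" unfolding n_def by (rule bh_count_le)
  show ?thesis
  proof (cases "n = 0")
    case True
    then have K: "K = {}" using n_ge by (force simp: K_def)
    have "\<not> q i \<le> 0"
    proof
      assume "q i \<le> 0"
      then have "i \<in> {j \<in> {1..m}. q j \<le> real 1 * \<alpha> / real m}"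
        using i \<alpha> by (auto intro: order_trans)
      then have "1 \<le> card {j \<in> {1..m}. q j \<le> real 1 * \<alpha> / real m}"
        by (simp add: Suc_le_eq card_gt_0_iff) auto
      then have "1 \<in> K" using i by (simp add: K_iff)
      with K show False by simp
    qed
    then show ?thesis
      using True K by (simp add: benjamini_hochberg_def K_def n_def q_def [abs_def])
  next
    case False
    then have nK: "n \<in> K" using n_card \<open>n \<le> m\<close> by (simp add: K_iff)
    have Max: "Max K = n" using n_ge nK by (intro Max_eqI) (auto simp: K_def)
    have "p_value \<sigma> (x i) \<le> ordered_p_value m \<sigma> x n \<longleftrightarrow> q i \<le> real n * \<alpha> / real m"
    proof
      assume "p_value \<sigma> (x i) \<le> ordered_p_value m \<sigma> x n"
      also have "\<dots> \<le> real n * \<alpha> / real m" using nK by (simp add: K_def)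
      finally show "q i \<le> real n * \<alpha> / real m" by (simp add: q_def)
    next
      assume qi: "q i \<le> real n * \<alpha> / real m"
      let ?t = "ordered_p_value m \<sigma> x n"
      show "p_value \<sigma> (x i) \<le> ?t"
      proof (rule ccontr)
        assume gt: "\<not> p_value \<sigma> (x i) \<le> ?t"
        \<comment> \<open>then \<open>n + 1\<close> p-values lie below the threshold, against the maximality of \<open>n\<close>\<close>
        have "n \<le> card {j \<in> {1..m}. p_value \<sigma> (x j) \<le> ?t}"
          using nK by (subst ordered_p_value_le_iff [symmetric]) (auto simp: K_def)
        then have "Suc n \<le> card (insert i {j \<in> {1..m}. q j \<le> ?t})"
          using gt by (subst card_insert_disjoint) (auto simp: q_def)
        also have "\<dots> \<le> card {j \<in> {1..m}. q j \<le> real (Suc n) * \<alpha> / real m}"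
        proof (rule card_mono)
          have "?t \<le> real n * \<alpha> / real m" using nK by (simp add: K_def)
          moreover have "real n * \<alpha> / real m \<le> real (Suc n) * \<alpha> / real m"
            using \<alpha> by (intro divide_right_mono mult_right_mono) auto
          ultimately show "insert i {j \<in> {1..m}. q j \<le> ?t} \<subseteq>
              {j \<in> {1..m}. q j \<le> real (Suc n) * \<alpha> / real m}"
            using i qi by auto
        qed simp
        finally have *: "Suc n \<le> card {j \<in> {1..m}. q j \<le> real (Suc n) * \<alpha> / real m}" .
        also have "\<dots> \<le> card {1..m}" by (rule card_mono) auto
        finally have "Suc n \<in> K" using * by (simp add: K_iff)
        then show False using n_ge [of "Suc n"] by simp
      qed
    qed
    moreover have "K \<noteq> {}" using nK by auto
    ultimately show ?thesis
      using i Max unfolding benjamini_hochberg_def Let_def K_def [symmetric] n_def q_def [abs_def]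
      by simp
  qed
qed

lemma measurable_bh_count:
  assumes q: "\<And>i. i \<in> {1..m} \<Longrightarrow> q i \<in> borel_measurable N"
  shows "(\<lambda>z. bh_count m \<alpha> A (\<lambda>i. q i z)) \<in> N \<rightarrow>\<^sub>M count_space UNIV"
proof -
  have c: "(\<lambda>z. card {i \<in> {1..m}. i \<in> A \<or> q i z \<le> t}) \<in> N \<rightarrow>\<^sub>M count_space UNIV" for t :: real
  proof -
    have "(\<lambda>z. \<Sum>i\<in>{1..m}. if i \<in> A \<or> q i z \<le> t then 1 else 0 :: nat) \<in> N \<rightarrow>\<^sub>M count_space UNIV"
    proof (rule measurable_sum_nat)
      fix i assume "i \<in> {1..m}"
      note [measurable] = q [OF this]
      show "(\<lambda>z. if i \<in> A \<or> q i z \<le> t then 1 else 0 :: nat) \<in> N \<rightarrow>\<^sub>M count_space UNIV"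
        by measurable
    qed
    also have "(\<lambda>z. \<Sum>i\<in>{1..m}. if i \<in> A \<or> q i z \<le> t then 1 else 0 :: nat) =
        (\<lambda>z. card {i \<in> {1..m}. i \<in> A \<or> q i z \<le> t})"
      by (rule ext, subst sum.inter_filter [symmetric]) auto
    finally show ?thesis .
  qed
  have m: "{z \<in> space N. k \<le> card {i \<in> {1..m}. i \<in> A \<or> q i z \<le> t}} \<in> sets N" for k t
    by (rule predE, rule measurable_compose [OF c [of t]]) simp
  have eq: "bh_count m \<alpha> A (\<lambda>i. q i z) = k \<longleftrightarrow>
      k \<in> {0..m} \<and> k \<le> card {i \<in> {1..m}. i \<in> A \<or> q i z \<le> real k * \<alpha> / real m} \<and>
      (\<forall>l\<in>{k<..m}. \<not> l \<le> card {i \<in> {1..m}. i \<in> A \<or> q i z \<le> real l * \<alpha> / real m})" for z k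
  proof -
    let ?P = "\<lambda>l. l \<le> card {i \<in> {1..m}. i \<in> A \<or> q i z \<le> real l * \<alpha> / real m}"
    have greatest: "l \<le> bh_count m \<alpha> A (\<lambda>i. q i z)" if "l \<le> m" "?P l" for l
      using that by (rule bh_count_greatest)
    have le: "bh_count m \<alpha> A (\<lambda>i. q i z) \<le> m" "?P (bh_count m \<alpha> A (\<lambda>i. q i z))"
      by (rule bh_count_le, rule bh_count_le_card)
    show ?thesis
    proof
      assume k: "bh_count m \<alpha> A (\<lambda>i. q i z) = k"
      have "\<not> ?P l" if "l \<in> {k<..m}" for l
        using greatest [of l] that unfolding k by auto
      with le show "k \<in> {0..m} \<and> ?P k \<and> (\<forall>l\<in>{k<..m}. \<not> ?P l)"
        unfolding k by simp
    next
      assume k: "k \<in> {0..m} \<and> ?P k \<and> (\<forall>l\<in>{k<..m}. \<not> ?P l)"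
      show "bh_count m \<alpha> A (\<lambda>i. q i z) = k"
      proof (rule antisym)
        show "k \<le> bh_count m \<alpha> A (\<lambda>i. q i z)" using k greatest by simp
        show "bh_count m \<alpha> A (\<lambda>i. q i z) \<le> k"
          using bspec [OF conjunct2 [OF conjunct2 [OF k]], of "bh_count m \<alpha> A (\<lambda>i. q i z)"] le
          by (metis greaterThanAtMost_iff not_le)
      qed
    qed
  qed
  show ?thesis
  proof (rule measurable_count_space_eq_countable [THEN iffD2])
    show "countable (UNIV :: nat set)" by simp
    show "(\<lambda>z. bh_count m \<alpha> A (\<lambda>i. q i z)) \<in> space N \<rightarrow> UNIV \<and>
      (\<forall>k\<in>UNIV. (\<lambda>z. bh_count m \<alpha> A (\<lambda>i. q i z)) -` {k} \<inter> space N \<in> sets N)"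
    proof (intro conjI ballI)
      fix k
      have "(\<lambda>z. bh_count m \<alpha> A (\<lambda>i. q i z)) -` {k} \<inter> space N =
          {z \<in> space N. bh_count m \<alpha> A (\<lambda>i. q i z) = k}" by auto
      also have "\<dots> \<in> sets N" unfolding eq
        by (intro sets.sets_Collect_conj sets.sets_Collect_finite_All sets.sets_Collect_neg
            sets.sets_Collect_const m finite_greaterThanAtMost)
      finally show "(\<lambda>z. bh_count m \<alpha> A (\<lambda>i. q i z)) -` {k} \<inter> space N \<in> sets N" .
    qed simp
  qed
qed


section \<open>Error probabilities of the Benjamini--Hochberg procedure\<close>

text \<open>Chebyshev's inequality for the number of pairwise independent events that occur.\<close>

lemma (in prob_space) pairwise_indep_events_lower_tail:
  fixes E :: "'i \<Rightarrow> 'a set"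
  assumes J: "finite J" and E: "\<And>j. j \<in> J \<Longrightarrow> E j \<in> events"
    and pair: "\<And>j k. j \<in> J \<Longrightarrow> k \<in> J \<Longrightarrow> j \<noteq> k \<Longrightarrow> prob (E j \<inter> E k) = prob (E j) * prob (E k)"
    and a: "a < (\<Sum>j\<in>J. prob (E j))"
  shows "\<P>(\<omega> in M. real (card {j \<in> J. \<omega> \<in> E j}) \<le> a) \<le>
    (\<Sum>j\<in>J. prob (E j)) / ((\<Sum>j\<in>J. prob (E j)) - a)\<^sup>2"
proof -
  define S where "S = (\<Sum>j\<in>J. prob (E j))"
  define N where "N \<omega> = (\<Sum>j\<in>J. indicator (E j) \<omega> :: real)" for \<omega>
  have N_card: "N \<omega> = real (card {j \<in> J. \<omega> \<in> E j})" for \<omega>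
    unfolding N_def indicator_def using J by (simp add: Int_def)
  have int1: "integrable M (indicator (E j) :: 'a \<Rightarrow> real)" if "j \<in> J" for j
    using E [OF that] by (simp add: less_top [symmetric])
  have int2: "integrable M (\<lambda>\<omega>. indicator (E j) \<omega> * indicator (E k) \<omega> :: real)"
    if "j \<in> J" "k \<in> J" for j k
    using E that by (simp add: indicator_inter_arith [symmetric] less_top [symmetric])
  have sq: "(N \<omega>)\<^sup>2 = (\<Sum>j\<in>J. \<Sum>k\<in>J. indicator (E j) \<omega> * indicator (E k) \<omega>)" for \<omega>
    by (simp add: N_def power2_eq_square sum_product)
  have iN: "integrable M N" unfolding N_def [abs_def] using int1 by (intro Bochner_Integration.integrable_sum)
  have iN2: "integrable M (\<lambda>\<omega>. (N \<omega>)\<^sup>2)"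
    unfolding sq using int2 by (intro Bochner_Integration.integrable_sum)
  have EN: "expectation N = S"
    unfolding N_def [abs_def] S_def using int1 E
    by (subst Bochner_Integration.integral_sum) auto
  have "expectation (\<lambda>\<omega>. (N \<omega>)\<^sup>2) = (\<Sum>j\<in>J. \<Sum>k\<in>J. prob (E j \<inter> E k))"
  proof -
    have "expectation (\<lambda>\<omega>. indicator (E j) \<omega> * indicator (E k) \<omega>) = prob (E j \<inter> E k)"
      if "j \<in> J" "k \<in> J" for j k
    proof -
      have "E j \<inter> E k \<in> events" using E that by blast
      then show ?thesis unfolding indicator_inter_arith [symmetric]
        by (simp add: Int_absorb1 sets.sets_into_space)
    qed
    then have "(\<Sum>j\<in>J. \<Sum>k\<in>J. prob (E j \<inter> E k)) =
        (\<Sum>j\<in>J. \<Sum>k\<in>J. expectation (\<lambda>\<omega>. indicator (E j) \<omega> * indicator (E k) \<omega>))"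
      by simp
    also have "\<dots> = (\<Sum>j\<in>J. expectation (\<lambda>\<omega>. \<Sum>k\<in>J. indicator (E j) \<omega> * indicator (E k) \<omega>))"
      by (intro sum.cong refl Bochner_Integration.integral_sum [symmetric] int2)
    also have "\<dots> = expectation (\<lambda>\<omega>. (N \<omega>)\<^sup>2)"
      unfolding sq
      by (intro Bochner_Integration.integral_sum [symmetric] Bochner_Integration.integrable_sum int2)
    finally show ?thesis by simp
  qed
  also have "\<dots> \<le> (\<Sum>j\<in>J. prob (E j) * S + prob (E j))"
  proof (rule sum_mono)
    fix j assume j: "j \<in> J"
    have "(\<Sum>k\<in>J. prob (E j \<inter> E k)) = prob (E j) + (\<Sum>k\<in>J - {j}. prob (E j) * prob (E k))"
      using J j pair by (subst sum.remove [of _ j]) (auto intro!: sum.cong)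
    also have "(\<Sum>k\<in>J - {j}. prob (E j) * prob (E k)) \<le> (\<Sum>k\<in>J. prob (E j) * prob (E k))"
      using J by (intro sum_mono2) auto
    finally show "(\<Sum>k\<in>J. prob (E j \<inter> E k)) \<le> prob (E j) * S + prob (E j)"
      by (simp add: S_def sum_distrib_left)
  qed
  also have "\<dots> = S\<^sup>2 + S"
    by (simp add: S_def sum.distrib sum_distrib_right [symmetric] power2_eq_square)
  finally have var: "variance N \<le> S"
    using iN iN2 by (subst variance_eq) (auto simp: EN)
  have rv: "random_variable borel N" using iN by auto
  have "\<P>(\<omega> in M. real (card {j \<in> J. \<omega> \<in> E j}) \<le> a) \<le> \<P>(\<omega> in M. S - a \<le> \<bar>N \<omega> - expectation N\<bar>)"
    using rv by (intro finite_measure_mono) (auto simp: N_card [symmetric] EN)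
  also have "\<dots> \<le> variance N / (S - a)\<^sup>2"
    using a rv iN2 by (intro Chebyshev_inequality) (auto simp: S_def)
  also have "\<dots> \<le> S / (S - a)\<^sup>2"
    using var by (intro divide_right_mono) auto
  finally show ?thesis by (simp add: S_def)
qed

context two_groups_model
begin

text \<open>
  The number of rejections of the Benjamini--Hochberg procedure, with the p-values in \<open>A\<close> set to \<open>0\<close>.
\<close>

definition rejections :: "real \<Rightarrow> nat set \<Rightarrow> 'a \<Rightarrow> nat" where
  "rejections \<alpha> A \<omega> = bh_count m \<alpha> A (\<lambda>i. p_value \<sigma> (X i \<omega>))"

lemma rejections_measurable [measurable]: "rejections \<alpha> A \<in> M \<rightarrow>\<^sub>M count_space UNIV"
  unfolding rejections_def [abs_def]
  by (intro measurable_bh_count measurable_compose [OF measurable_X p_value_measurable])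

lemma rejections_le: "rejections \<alpha> A \<omega> \<le> m"
  unfolding rejections_def by (rule bh_count_le)

lemma integrable_rejections: "integrable M (\<lambda>\<omega>. real (rejections \<alpha> A \<omega>))"
  by (rule integrable_const_bound [of _ "real m"])
     (use rejections_le in \<open>auto intro!: measurable_compose [OF rejections_measurable]\<close>)

lemma in_benjamini_hochberg_iff:
  assumes "0 \<le> \<alpha>" "i \<in> {1..m}"
  shows "i \<in> benjamini_hochberg m \<sigma> \<alpha> (observations m X \<omega>) \<longleftrightarrow>
    p_value \<sigma> (X i \<omega>) \<le> real (rejections \<alpha> {} \<omega>) * \<alpha> / real m"
proof -
  have "bh_count m \<alpha> {} (\<lambda>j. p_value \<sigma> (observations m X \<omega> j)) = rejections \<alpha> {} \<omega>"
    unfolding rejections_def by (rule bh_count_cong) (simp add: observations_def)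
  then show ?thesis
    using benjamini_hochberg_iff [OF assms] assms by (simp add: observations_def)
qed

lemma p_value_le_rejections_iff:
  assumes "0 \<le> \<alpha>"
  shows "p_value \<sigma> (X i \<omega>) \<le> real (rejections \<alpha> A \<omega>) * \<alpha> / real m \<longleftrightarrow>
    p_value \<sigma> (X i \<omega>) \<le> real (rejections \<alpha> (insert i A) \<omega>) * \<alpha> / real m"
  unfolding rejections_def
  using bh_count_insert_iff [of \<alpha> m "\<lambda>i. p_value \<sigma> (X i \<omega>)" i A] assms m_ge_1 by simp

lemma test_event:
  assumes "i \<in> {1..m}" "B \<in> sets borel"
  shows "{\<omega> \<in> space M. \<nu> i \<omega> = b \<and> X i \<omega> \<in> B} \<in> events"
proof -
  have [measurable]: "\<nu> i \<in> M \<rightarrow>\<^sub>M count_space UNIV" "X i \<in> borel_measurable M"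
    using assms by (auto intro: measurable_nu measurable_X)
  show ?thesis using assms(2) by measurable
qed

lemma test_rejections_event:
  assumes "i \<in> {1..m}" "B \<in> sets borel"
  shows "{\<omega> \<in> space M. (\<nu> i \<omega> = b \<and> X i \<omega> \<in> B) \<and> rejections \<alpha> A \<omega> \<in> K} \<in> events"
proof -
  have "{\<omega> \<in> space M. (\<nu> i \<omega> = b \<and> X i \<omega> \<in> B) \<and> rejections \<alpha> A \<omega> \<in> K} =
      {\<omega> \<in> space M. \<nu> i \<omega> = b \<and> X i \<omega> \<in> B} \<inter> (rejections \<alpha> A -` K \<inter> space M)" by auto
  then show ?thesis
    using test_event [OF assms, of b] measurable_sets [OF rejections_measurable, of K \<alpha> A] by simp
qed

lemma prob_null_in:
  assumes "i \<in> {1..m}" "B \<in> sets borel"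
  shows "\<P>(\<omega> in M. \<not> \<nu> i \<omega> \<and> X i \<omega> \<in> B) = (1 - p) * measure (centred_normal \<sigma>) B"
proof -
  have "{\<omega> \<in> space M. X i \<omega> \<in> B \<and> \<not> \<nu> i \<omega>} = {\<omega> \<in> space M. \<not> \<nu> i \<omega> \<and> X i \<omega> \<in> B}" by auto
  with law_null [OF assms] have
    "\<P>(\<omega> in M. \<not> \<nu> i \<omega> \<and> X i \<omega> \<in> B) / (1 - p) = measure (centred_normal \<sigma>) B"
    by (simp only: cond_prob_def prob_null [OF assms(1)])
  then show ?thesis using p_less_1 by (simp add: divide_eq_eq mult_ac)
qed

lemma prob_alternative_in:
  assumes "i \<in> {1..m}" "B \<in> sets borel"
  shows "\<P>(\<omega> in M. \<nu> i \<omega> \<and> X i \<omega> \<in> B) = p * measure (centred_normal (sqrt (\<sigma>\<^sup>2 + \<tau>\<^sup>2))) B"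
proof -
  have "{\<omega> \<in> space M. X i \<omega> \<in> B \<and> \<nu> i \<omega>} = {\<omega> \<in> space M. \<nu> i \<omega> \<and> X i \<omega> \<in> B}" by auto
  with law_alternative [OF assms] have
    "\<P>(\<omega> in M. \<nu> i \<omega> \<and> X i \<omega> \<in> B) / p = measure (centred_normal (sqrt (\<sigma>\<^sup>2 + \<tau>\<^sup>2))) B"
    by (simp only: cond_prob_def prob_alternative [OF assms(1)])
  then show ?thesis using p_pos by (simp add: divide_eq_eq mult_ac)
qed

lemma sqrt_variance_pos: "0 < sqrt (\<sigma>\<^sup>2 + \<tau>\<^sup>2)"
  using sigma_pos by (simp add: add_pos_nonneg)

text \<open>Once the \<open>i\<close>-th p-value has been set to \<open>0\<close>, the number of rejections is independent of test \<open>i\<close>.\<close>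

lemma rejections_indep:
  assumes i: "i \<in> {1..m}" "i \<in> A" and B: "B \<in> sets borel"
  shows "\<P>(\<omega> in M. (\<nu> i \<omega> = b \<and> X i \<omega> \<in> B) \<and> rejections \<alpha> A \<omega> \<in> K) =
    \<P>(\<omega> in M. \<nu> i \<omega> = b \<and> X i \<omega> \<in> B) * \<P>(\<omega> in M. rejections \<alpha> A \<omega> \<in> K)"
proof -
  define J where "J = {1..m} - {i}"
  define P0 where "P0 = count_space (UNIV :: bool set) \<Otimes>\<^sub>M (borel :: real measure)"
  define N where "N = PiM J (\<lambda>_. P0)"
  define Y where "Y = (\<lambda>\<omega>. restrict (\<lambda>i. (\<nu> i \<omega>, X i \<omega>)) {i})"
  define Z where "Z = (\<lambda>\<omega>. restrict (\<lambda>i. (\<nu> i \<omega>, X i \<omega>)) J)"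
  define q where "q j z = (if j = i then 0 else p_value \<sigma> (snd (z j)))" for j and z :: "nat \<Rightarrow> bool \<times> real"
  have ind: "indep_var (PiM {i} (\<lambda>_. P0)) Y N Z"
    unfolding N_def P0_def Y_def Z_def
    by (rule indep_var_restrict [OF indep]) (use i in \<open>auto simp: J_def\<close>)
  have "q j \<in> borel_measurable N" if j: "j \<in> {1..m}" for j
  proof (cases "j = i")
    case True
    then show ?thesis by (simp add: q_def [abs_def])
  next
    case False
    then have "(\<lambda>z. z j) \<in> N \<rightarrow>\<^sub>M P0"
      using j unfolding N_def by (intro measurable_component_singleton) (auto simp: J_def)
    moreover have "snd \<in> P0 \<rightarrow>\<^sub>M borel" unfolding P0_def by (rule measurable_snd)
    ultimately have "(\<lambda>z. snd (z j)) \<in> borel_measurable N" by (rule measurable_compose)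
    then have "(\<lambda>z. p_value \<sigma> (snd (z j))) \<in> borel_measurable N"
      by (rule measurable_compose [OF _ p_value_measurable])
    with False show ?thesis by (simp add: q_def [abs_def])
  qed
  then have F: "(\<lambda>z. bh_count m \<alpha> A (\<lambda>j. q j z)) \<in> N \<rightarrow>\<^sub>M count_space UNIV"
    by (rule measurable_bh_count)
  have FZ: "bh_count m \<alpha> A (\<lambda>j. q j (Z \<omega>)) = rejections \<alpha> A \<omega>" for \<omega>
    unfolding rejections_def
    by (rule bh_count_cong) (use i in \<open>auto simp: q_def Z_def J_def\<close>)
  define V where "V = (\<lambda>z. bh_count m \<alpha> A (\<lambda>j. q j z)) -` K \<inter> space N"
  define U where "U = (\<lambda>y. y i) -` ({b} \<times> B) \<inter> space (PiM {i} (\<lambda>_. P0))"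
  have V: "V \<in> sets N" unfolding V_def by (rule measurable_sets [OF F]) simp
  have U: "U \<in> sets (PiM {i} (\<lambda>_. P0))"
    unfolding U_def
  proof (rule measurable_sets)
    show "(\<lambda>y. y i) \<in> PiM {i} (\<lambda>_. P0) \<rightarrow>\<^sub>M P0" by (rule measurable_component_singleton) simp
    show "{b} \<times> B \<in> sets P0" unfolding P0_def using B by (intro pair_measureI) auto
  qed
  have sp: "Y \<omega> \<in> space (PiM {i} (\<lambda>_. P0))" "Z \<omega> \<in> space N" for \<omega>
    by (auto simp: Y_def Z_def N_def P0_def space_PiM space_pair_measure)
  have "prob ((\<lambda>\<omega>. (Y \<omega>, Z \<omega>)) -` (U \<times> V) \<inter> space M) =
      prob (Y -` U \<inter> space M) * prob (Z -` V \<inter> space M)"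
    by (rule indep_varD [OF ind U V])
  moreover have "(\<lambda>\<omega>. (Y \<omega>, Z \<omega>)) -` (U \<times> V) \<inter> space M =
      {\<omega> \<in> space M. (\<nu> i \<omega> = b \<and> X i \<omega> \<in> B) \<and> rejections \<alpha> A \<omega> \<in> K}"
    using sp by (auto simp: U_def V_def FZ) (auto simp: Y_def)
  moreover have "Y -` U \<inter> space M = {\<omega> \<in> space M. \<nu> i \<omega> = b \<and> X i \<omega> \<in> B}"
    using sp by (auto simp: U_def) (auto simp: Y_def)
  moreover have "Z -` V \<inter> space M = {\<omega> \<in> space M. rejections \<alpha> A \<omega> \<in> K}"
    using sp by (auto simp: V_def FZ)
  ultimately show ?thesis by simp
qed

lemma expectation_rejections:
  "expectation (\<lambda>\<omega>. real (rejections \<alpha> A \<omega>)) =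
    (\<Sum>k\<in>{1..m}. real k * \<P>(\<omega> in M. rejections \<alpha> A \<omega> \<in> {k}))"
proof -
  have "expectation (\<lambda>\<omega>. real (rejections \<alpha> A \<omega>)) =
      expectation (\<lambda>\<omega>. \<Sum>k\<in>{1..m}. real k * indicator {\<omega> \<in> space M. rejections \<alpha> A \<omega> \<in> {k}} \<omega>)"
  proof (rule Bochner_Integration.integral_cong [OF refl])
    fix \<omega> assume "\<omega> \<in> space M"
    then have "(\<Sum>k\<in>{1..m}. real k * indicator {\<omega> \<in> space M. rejections \<alpha> A \<omega> \<in> {k}} \<omega>) =
        (\<Sum>k\<in>{1..m}. if rejections \<alpha> A \<omega> = k then real k else 0)"
      by (intro sum.cong) (auto simp: indicator_def)
    also have "\<dots> = real (rejections \<alpha> A \<omega>)"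
      using rejections_le [of \<alpha> A \<omega>] by (subst sum.delta') auto
    finally show "real (rejections \<alpha> A \<omega>) =
        (\<Sum>k\<in>{1..m}. real k * indicator {\<omega> \<in> space M. rejections \<alpha> A \<omega> \<in> {k}} \<omega>)" by simp
  qed
  also have "\<dots> = (\<Sum>k\<in>{1..m}. real k * \<P>(\<omega> in M. rejections \<alpha> A \<omega> \<in> {k}))"
    by (subst Bochner_Integration.integral_sum) (auto simp: less_top [symmetric])
  finally show ?thesis .
qed

lemma false_rejection_le:
  assumes \<alpha>: "0 < \<alpha>" and i: "i \<in> {1..m}"
  shows "\<P>(\<omega> in M. \<not> \<nu> i \<omega> \<and> p_value \<sigma> (X i \<omega>) \<le> real (rejections \<alpha> A \<omega>) * \<alpha> / real m) \<le>
    \<alpha> / real m * expectation (\<lambda>\<omega>. real (rejections \<alpha> (insert i A) \<omega>))"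
proof -
  define T where "T k = {x. p_value \<sigma> x \<le> real k * \<alpha> / real m}" for k :: nat
  have T: "T k \<in> sets borel" for k unfolding T_def by measurable
  define E where "E k = {\<omega> \<in> space M. (\<nu> i \<omega> = False \<and> X i \<omega> \<in> T k) \<and> rejections \<alpha> (insert i A) \<omega> \<in> {k}}"
    for k
  have E: "E k \<in> events" for k
    unfolding E_def by (rule test_rejections_event [OF i T])
  have "\<P>(\<omega> in M. \<not> \<nu> i \<omega> \<and> p_value \<sigma> (X i \<omega>) \<le> real (rejections \<alpha> A \<omega>) * \<alpha> / real m) \<le>
      prob (\<Union>k\<in>{1..m}. E k)"
  proof (rule finite_measure_mono)
    show "{\<omega> \<in> space M. \<not> \<nu> i \<omega> \<and> p_value \<sigma> (X i \<omega>) \<le> real (rejections \<alpha> A \<omega>) * \<alpha> / real m} \<subseteq>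
        (\<Union>k\<in>{1..m}. E k)"
    proof
      fix \<omega>
      assume "\<omega> \<in> {\<omega> \<in> space M. \<not> \<nu> i \<omega> \<and> p_value \<sigma> (X i \<omega>) \<le> real (rejections \<alpha> A \<omega>) * \<alpha> / real m}"
      then have "\<omega> \<in> E (rejections \<alpha> (insert i A) \<omega>)"
        using p_value_le_rejections_iff [of \<alpha> i \<omega> A] \<alpha> by (simp add: E_def T_def)
      moreover have "rejections \<alpha> (insert i A) \<omega> \<in> {1..m}"
        using rejections_le bh_count_pos [OF i, of "insert i A"] by (simp add: rejections_def)
      ultimately show "\<omega> \<in> (\<Union>k\<in>{1..m}. E k)" by blast
    qed
  qed (use E in auto)
  also have "\<dots> \<le> (\<Sum>k\<in>{1..m}. prob (E k))"
    using E by (intro finite_measure_subadditive_finite) auto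
  also have "\<dots> \<le> (\<Sum>k\<in>{1..m}. \<alpha> / real m * (real k * \<P>(\<omega> in M. rejections \<alpha> (insert i A) \<omega> \<in> {k})))"
  proof (rule sum_mono)
    fix k assume k: "k \<in> {1..m}"
    have "\<P>(\<omega> in M. \<nu> i \<omega> = False \<and> X i \<omega> \<in> T k) = (1 - p) * measure (centred_normal \<sigma>) (T k)"
      using prob_null_in [OF i T] by simp
    also have "\<dots> \<le> 1 * (real k * \<alpha> / real m)"
      using measure_p_value_le [OF sigma_pos, of "real k * \<alpha> / real m"] \<alpha> k m_ge_1 p_pos p_less_1
      by (intro mult_mono) (auto simp: T_def)
    finally have "\<P>(\<omega> in M. \<nu> i \<omega> = False \<and> X i \<omega> \<in> T k) \<le> real k * \<alpha> / real m" by simp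
    then have "prob (E k) \<le> real k * \<alpha> / real m * \<P>(\<omega> in M. rejections \<alpha> (insert i A) \<omega> \<in> {k})"
      unfolding E_def by (subst rejections_indep [OF i insertI1 T]) (intro mult_right_mono, auto)
    then show "prob (E k) \<le> \<alpha> / real m * (real k * \<P>(\<omega> in M. rejections \<alpha> (insert i A) \<omega> \<in> {k}))"
      by (simp add: mult_ac)
  qed
  also have "\<dots> = \<alpha> / real m * expectation (\<lambda>\<omega>. real (rejections \<alpha> (insert i A) \<omega>))"
    by (simp only: expectation_rejections sum_distrib_left)
  finally show ?thesis .
qed

text \<open>
  Splitting the rejections into those in \<open>A\<close>, true and false ones bounds the expectation for \<open>A\<close> by
  the one for a set with one more element; the recursion ends at \<open>A = {1..m}\<close>.
\<close>

lemma expectation_rejections_le: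
  assumes \<alpha>: "0 < \<alpha>" "\<alpha> < 1" and A: "A \<subseteq> {1..m}"
  shows "expectation (\<lambda>\<omega>. real (rejections \<alpha> A \<omega>)) \<le>
    (real (card A) + real m * p) / (1 - \<alpha>) + \<alpha> / (1 - \<alpha>)\<^sup>2"
  using A
proof (induction "m - card A" arbitrary: A rule: less_induct)
  case less
  define b where "b = (real (card A) + 1 + real m * p) / (1 - \<alpha>) + \<alpha> / (1 - \<alpha>)\<^sup>2"
  define FR where
    "FR i = {\<omega> \<in> space M. \<not> \<nu> i \<omega> \<and> p_value \<sigma> (X i \<omega>) \<le> real (rejections \<alpha> A \<omega>) * \<alpha> / real m}" for i
  define Al where "Al i = {\<omega> \<in> space M. \<nu> i \<omega>}" for i
  have fin: "finite A" using less.prems finite_subset by blast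
  have FR: "FR i \<in> events" and Al: "Al i \<in> events" if i: "i \<in> {1..m}" for i
  proof -
    have [measurable]: "\<nu> i \<in> M \<rightarrow>\<^sub>M count_space UNIV" "X i \<in> borel_measurable M"
      using i by (auto intro: measurable_nu measurable_X)
    have [measurable]: "(\<lambda>\<omega>. real (rejections \<alpha> A \<omega>)) \<in> borel_measurable M"
      by (rule measurable_compose [OF rejections_measurable]) simp
    show "FR i \<in> events" "Al i \<in> events" unfolding FR_def Al_def by measurable
  qed
  have b: "0 \<le> b" unfolding b_def using \<alpha> p_pos by (intro add_nonneg_nonneg divide_nonneg_nonneg) auto
  have ptw: "real (rejections \<alpha> A \<omega>) \<le>
      real (card A) + (\<Sum>i\<in>{1..m} - A. indicator (Al i) \<omega> + indicator (FR i) \<omega>)" if w: "\<omega> \<in> space M" for \<omega>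
  proof -
    let ?R = "{i \<in> {1..m} - A. p_value \<sigma> (X i \<omega>) \<le> real (rejections \<alpha> A \<omega>) * \<alpha> / real m}"
    have "rejections \<alpha> A \<omega> \<le>
        card {i \<in> {1..m}. i \<in> A \<or> p_value \<sigma> (X i \<omega>) \<le> real (rejections \<alpha> A \<omega>) * \<alpha> / real m}"
      unfolding rejections_def by (rule bh_count_le_card)
    also have "\<dots> \<le> card (A \<union> ?R)" using fin by (intro card_mono) auto
    also have "\<dots> \<le> card A + card ?R" by (rule card_Un_le)
    finally have "real (rejections \<alpha> A \<omega>) \<le> real (card A) + real (card ?R)" by linarith
    also have "real (card ?R) = (\<Sum>i\<in>{1..m} - A.
        if p_value \<sigma> (X i \<omega>) \<le> real (rejections \<alpha> A \<omega>) * \<alpha> / real m then 1 else 0)"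
      by (subst sum.inter_filter [symmetric]) auto
    also have "\<dots> \<le> (\<Sum>i\<in>{1..m} - A. indicator (Al i) \<omega> + indicator (FR i) \<omega>)"
      using w by (intro sum_mono) (auto simp: Al_def FR_def indicator_def)
    finally show ?thesis by simp
  qed
  have int: "integrable M (\<lambda>\<omega>. indicator (Al i) \<omega> + indicator (FR i) \<omega> :: real)" if "i \<in> {1..m} - A" for i
    using that Al FR by (intro Bochner_Integration.integrable_add) (auto simp: less_top [symmetric])
  have "expectation (\<lambda>\<omega>. real (rejections \<alpha> A \<omega>)) \<le> expectation (\<lambda>\<omega>.
      real (card A) + (\<Sum>i\<in>{1..m} - A. indicator (Al i) \<omega> + indicator (FR i) \<omega>))"
    by (intro integral_mono integrable_rejections ptw Bochner_Integration.integrable_add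
        Bochner_Integration.integrable_sum int) simp_all
  also have "\<dots> = real (card A) + (\<Sum>i\<in>{1..m} - A. prob (Al i) + prob (FR i))"
  proof -
    have "expectation (\<lambda>\<omega>. indicator (Al i) \<omega> + indicator (FR i) \<omega> :: real) = prob (Al i) + prob (FR i)"
      if "i \<in> {1..m} - A" for i
      using that Al FR by (subst Bochner_Integration.integral_add) (auto simp: less_top [symmetric])
    then show ?thesis
      using int by (subst Bochner_Integration.integral_add)
        (auto simp: prob_space Bochner_Integration.integral_sum
          simp del: atLeastAtMost_iff intro!: Bochner_Integration.integrable_sum)
  qed
  also have "\<dots> \<le> real (card A) + (\<Sum>i\<in>{1..m}. p + \<alpha> / real m * b)"
  proof (rule add_left_mono)
    have "(\<Sum>i\<in>{1..m} - A. prob (Al i) + prob (FR i)) \<le> (\<Sum>i\<in>{1..m} - A. p + \<alpha> / real m * b)"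
    proof (rule sum_mono)
      fix i assume i: "i \<in> {1..m} - A"
      then have card: "card (insert i A) = Suc (card A)" using fin by simp
      have sub: "insert i A \<subseteq> {1..m}" using i less.prems by auto
      then have "card (insert i A) \<le> card {1..m}" by (intro card_mono) auto
      then have "m - card (insert i A) < m - card A" using card by simp
      from less.hyps [OF this sub]
      have "expectation (\<lambda>\<omega>. real (rejections \<alpha> (insert i A) \<omega>)) \<le> b"
        by (simp add: card b_def add_ac)
      then have "prob (FR i) \<le> \<alpha> / real m * b"
        using \<alpha> i unfolding FR_def
        by (intro order_trans [OF false_rejection_le] mult_left_mono) auto
      moreover have "prob (Al i) = p" using prob_alternative i by (simp add: Al_def)
      ultimately show "prob (Al i) + prob (FR i) \<le> p + \<alpha> / real m * b" by simp
    qed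
    also have "\<dots> \<le> (\<Sum>i\<in>{1..m}. p + \<alpha> / real m * b)"
      using \<alpha> p_pos b by (intro sum_mono2) auto
    finally show "(\<Sum>i\<in>{1..m} - A. prob (Al i) + prob (FR i)) \<le> (\<Sum>i\<in>{1..m}. p + \<alpha> / real m * b)" .
  qed
  also have "\<dots> = real (card A) + real m * p + \<alpha> * b"
    using m_ge_1 by (simp add: field_simps)
  also have "\<dots> = (real (card A) + real m * p) / (1 - \<alpha>) + \<alpha> / (1 - \<alpha>)\<^sup>2"
  proof -
    have "a + \<alpha> * ((a + 1) / d + \<alpha> / d\<^sup>2) = a / d + \<alpha> / d\<^sup>2" if "d \<noteq> 0" "\<alpha> = 1 - d" for a d :: real
      using that(1) unfolding that(2) by (simp add: divide_simps power2_eq_square) algebra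
    from this [of "1 - \<alpha>" "real (card A) + real m * p"] show ?thesis
      using \<alpha> by (simp add: b_def add_ac)
  qed
  finally show ?case .
qed

lemma sum_false_rejection_le:
  assumes \<alpha>: "0 < \<alpha>" "\<alpha> < 1"
  shows "(\<Sum>i\<in>{1..m}. \<P>(\<omega> in M. \<not> \<nu> i \<omega> \<and> i \<in> benjamini_hochberg m \<sigma> \<alpha> (observations m X \<omega>))) \<le>
    \<alpha> / (1 - \<alpha>) * (real m * p + 1 / (1 - \<alpha>))"
proof -
  define b where "b = (1 + real m * p) / (1 - \<alpha>) + \<alpha> / (1 - \<alpha>)\<^sup>2"
  have "(\<Sum>i\<in>{1..m}. \<P>(\<omega> in M. \<not> \<nu> i \<omega> \<and> i \<in> benjamini_hochberg m \<sigma> \<alpha> (observations m X \<omega>))) \<le>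
      (\<Sum>i\<in>{1..m}. \<alpha> / real m * b)"
  proof (rule sum_mono)
    fix i assume i: "i \<in> {1..m}"
    have "\<P>(\<omega> in M. \<not> \<nu> i \<omega> \<and> i \<in> benjamini_hochberg m \<sigma> \<alpha> (observations m X \<omega>)) \<le>
        \<alpha> / real m * expectation (\<lambda>\<omega>. real (rejections \<alpha> {i} \<omega>))"
      using false_rejection_le [OF \<alpha>(1) i, of "{}"] in_benjamini_hochberg_iff [OF _ i] \<alpha> by simp
    also have "\<dots> \<le> \<alpha> / real m * b"
      using expectation_rejections_le [OF \<alpha>, of "{i}"] i \<alpha> by (intro mult_left_mono) (auto simp: b_def)
    finally show "\<P>(\<omega> in M. \<not> \<nu> i \<omega> \<and> i \<in> benjamini_hochberg m \<sigma> \<alpha> (observations m X \<omega>)) \<le> \<alpha> / real m * b" .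
  qed
  also have "\<dots> = \<alpha> * b" using m_ge_1 by simp
  also have "b = 1 / (1 - \<alpha>) * (real m * p + 1 / (1 - \<alpha>))"
  proof -
    have "(1 + a) / d + \<alpha> / d\<^sup>2 = 1 / d * (a + 1 / d)" if "d \<noteq> 0" "\<alpha> = 1 - d" for a d :: real
      using that(1) unfolding that(2) by (simp add: divide_simps power2_eq_square) algebra
    from this [of "1 - \<alpha>" "real m * p"] show ?thesis using \<alpha> by (simp add: b_def)
  qed
  finally show ?thesis by simp
qed

text \<open>
  A true effect is missed only if its observation is below \<open>c \<sigma>\<close> or if fewer than \<open>k\<close> hypotheses are
  rejected, provided that \<open>c\<close> is large enough for the \<open>k\<close>-th step.
\<close>

lemma false_acceptance_le:
  assumes \<alpha>: "0 < \<alpha>" and i: "i \<in> {1..m}" and c: "0 \<le> c"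
    and k: "2 * exp (- c\<^sup>2 / 2) \<le> real k * \<alpha> / real m"
  shows "\<P>(\<omega> in M. \<nu> i \<omega> \<and> i \<notin> benjamini_hochberg m \<sigma> \<alpha> (observations m X \<omega>)) \<le>
    p * (central_mass (c * \<sigma> / sqrt (\<sigma>\<^sup>2 + \<tau>\<^sup>2)) + \<P>(\<omega> in M. rejections \<alpha> {i} \<omega> \<in> {..<k}))"
proof -
  define E where "E = {\<omega> \<in> space M. \<nu> i \<omega> \<and> X i \<omega> \<in> {x. \<bar>x\<bar> < c * \<sigma>}}"
  define F where "F = {\<omega> \<in> space M. (\<nu> i \<omega> = True \<and> X i \<omega> \<in> UNIV) \<and> rejections \<alpha> {i} \<omega> \<in> {..<k}}"
  have E: "E \<in> events" using test_event [OF i, of "{x. \<bar>x\<bar> < c * \<sigma>}" True] by (simp add: E_def)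
  have F: "F \<in> events"
    unfolding F_def by (rule test_rejections_event [OF i]) simp
  have "\<P>(\<omega> in M. \<nu> i \<omega> \<and> i \<notin> benjamini_hochberg m \<sigma> \<alpha> (observations m X \<omega>)) \<le> prob (E \<union> F)"
  proof (rule finite_measure_mono)
    show "{\<omega> \<in> space M. \<nu> i \<omega> \<and> i \<notin> benjamini_hochberg m \<sigma> \<alpha> (observations m X \<omega>)} \<subseteq> E \<union> F"
    proof
      fix \<omega> assume w: "\<omega> \<in> {\<omega> \<in> space M. \<nu> i \<omega> \<and> i \<notin> benjamini_hochberg m \<sigma> \<alpha> (observations m X \<omega>)}"
      have "\<omega> \<in> F" if "\<omega> \<notin> E"
      proof (rule ccontr)
        assume "\<omega> \<notin> F"
        then have kr: "k \<le> rejections \<alpha> {i} \<omega>" using w by (auto simp: F_def)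
        have "c * \<sigma> \<le> \<bar>X i \<omega>\<bar>" using that w by (auto simp: E_def)
        then have "p_value \<sigma> (X i \<omega>) \<le> 2 * exp (- c\<^sup>2 / 2)"
          using c by (intro p_value_le_exp [OF sigma_pos]) auto
        also have "\<dots> \<le> real k * \<alpha> / real m" by (rule k)
        also have "\<dots> \<le> real (rejections \<alpha> {i} \<omega>) * \<alpha> / real m"
          using kr \<alpha> by (intro divide_right_mono mult_right_mono) auto
        finally show False
          using w p_value_le_rejections_iff [of \<alpha> i \<omega> "{}"] \<alpha> in_benjamini_hochberg_iff [OF _ i, of \<alpha> \<omega>]
          by simp
      qed
      then show "\<omega> \<in> E \<union> F" by blast
    qed
  qed (use E F in auto)
  also have "\<dots> \<le> prob E + prob F" using E F by (rule measure_Un_le)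
  also have "prob E = p * central_mass (c * \<sigma> / sqrt (\<sigma>\<^sup>2 + \<tau>\<^sup>2))"
    unfolding E_def using prob_alternative_in [OF i, of "{x. \<bar>x\<bar> < c * \<sigma>}"]
    by (simp add: measure_centred_normal_central [OF sqrt_variance_pos])
  also have "prob F = p * \<P>(\<omega> in M. rejections \<alpha> {i} \<omega> \<in> {..<k})"
    unfolding F_def using prob_alternative [OF i]
    by (subst rejections_indep [OF i]) auto
  finally show ?thesis by (simp add: distrib_left)
qed

text \<open>Few rejections are unlikely, since many true effects produce observations beyond \<open>c \<sigma>\<close>.\<close>

lemma few_rejections_le:
  assumes \<alpha>: "0 < \<alpha>" and i: "i \<in> {1..m}" and c: "0 \<le> c"
    and k: "k \<le> m" "2 * exp (- c\<^sup>2 / 2) \<le> real k * \<alpha> / real m"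
    and S: "S = (real m - 1) * p * (1 - central_mass (c * \<sigma> / sqrt (\<sigma>\<^sup>2 + \<tau>\<^sup>2)))"
    and a: "real k - 1 \<le> a" "a < S"
  shows "\<P>(\<omega> in M. rejections \<alpha> {i} \<omega> \<in> {..<k}) \<le> S / (S - a)\<^sup>2"
proof -
  define J where "J = {1..m} - {i}"
  have finite_J: "finite J" by (simp add: J_def)
  define B where "B = {x :: real. c * \<sigma> \<le> \<bar>x\<bar>}"
  define E where "E j = {\<omega> \<in> space M. \<nu> j \<omega> \<and> X j \<omega> \<in> B}" for j
  have B: "B \<in> sets borel" unfolding B_def by measurable
  have E: "E j \<in> events" if "j \<in> J" for j
    using test_event [OF _ B, of j True] that by (simp add: E_def J_def)
  have prob_E: "prob (E j) = p * (1 - central_mass (c * \<sigma> / sqrt (\<sigma>\<^sup>2 + \<tau>\<^sup>2)))" if "j \<in> J" for j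
  proof -
    interpret N: prob_space "centred_normal (sqrt (\<sigma>\<^sup>2 + \<tau>\<^sup>2))"
      unfolding centred_normal_def using sqrt_variance_pos by (rule prob_space_normal_density)
    have "B = space (centred_normal (sqrt (\<sigma>\<^sup>2 + \<tau>\<^sup>2))) - {x. \<bar>x\<bar> < c * \<sigma>}"
      by (auto simp: B_def centred_normal_def)
    then have "N.prob B = 1 - N.prob {x. \<bar>x\<bar> < c * \<sigma>}"
      by (simp only:) (rule N.prob_compl, simp add: centred_normal_def)
    then have "N.prob B = 1 - central_mass (c * \<sigma> / sqrt (\<sigma>\<^sup>2 + \<tau>\<^sup>2))"
      by (simp add: measure_centred_normal_central [OF sqrt_variance_pos])
    then show ?thesis using prob_alternative_in [OF _ B, of j] that by (simp add: E_def J_def)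
  qed
  have S_sum: "(\<Sum>j\<in>J. prob (E j)) = S"
    using i m_ge_1 by (simp add: prob_E S J_def of_nat_diff)
  have pair: "prob (E j \<inter> E l) = prob (E j) * prob (E l)" if "j \<in> J" "l \<in> J" "j \<noteq> l" for j l
  proof -
    have "prob (\<Inter>n\<in>{j, l}. (\<lambda>\<omega>. (\<nu> n \<omega>, X n \<omega>)) -` ({True} \<times> B) \<inter> space M) =
        (\<Prod>n\<in>{j, l}. prob ((\<lambda>\<omega>. (\<nu> n \<omega>, X n \<omega>)) -` ({True} \<times> B) \<inter> space M))"
      using that B by (intro indep_varsD [OF indep]) (auto simp: J_def)
    moreover have "(\<lambda>\<omega>. (\<nu> n \<omega>, X n \<omega>)) -` ({True} \<times> B) \<inter> space M = E n" for n
      by (auto simp: E_def)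
    ultimately show ?thesis using that by simp
  qed
  have "\<P>(\<omega> in M. rejections \<alpha> {i} \<omega> \<in> {..<k}) \<le> \<P>(\<omega> in M. real (card {j \<in> J. \<omega> \<in> E j}) \<le> a)"
  proof (rule finite_measure_mono)
    show "{\<omega> \<in> space M. rejections \<alpha> {i} \<omega> \<in> {..<k}} \<subseteq> {\<omega> \<in> space M. real (card {j \<in> J. \<omega> \<in> E j}) \<le> a}"
    proof
      fix \<omega> assume w: "\<omega> \<in> {\<omega> \<in> space M. rejections \<alpha> {i} \<omega> \<in> {..<k}}"
      let ?R = "{j \<in> {1..m}. j \<in> {i} \<or> p_value \<sigma> (X j \<omega>) \<le> real k * \<alpha> / real m}"
      have "p_value \<sigma> (X j \<omega>) \<le> real k * \<alpha> / real m" if "\<omega> \<in> E j" for j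
        using that c by (intro order_trans [OF p_value_le_exp [OF sigma_pos] k(2)]) (auto simp: E_def B_def)
      then have "card (insert i {j \<in> J. \<omega> \<in> E j}) \<le> card ?R"
        using i by (intro card_mono) (auto simp: J_def)
      moreover have "card (insert i {j \<in> J. \<omega> \<in> E j}) = Suc (card {j \<in> J. \<omega> \<in> E j})"
        by (subst card_insert_disjoint) (auto simp: J_def)
      moreover have "card ?R < k"
      proof (rule ccontr)
        assume "\<not> card ?R < k"
        then have "k \<le> rejections \<alpha> {i} \<omega>"
          unfolding rejections_def using k by (intro bh_count_greatest) auto
        with w show False by simp
      qed
      ultimately have "real (card {j \<in> J. \<omega> \<in> E j}) \<le> real k - 1" by linarith
      with a w show "\<omega> \<in> {\<omega> \<in> space M. real (card {j \<in> J. \<omega> \<in> E j}) \<le> a}" by simp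
    qed
    have "(\<lambda>\<omega>. \<Sum>j\<in>J. indicator (E j) \<omega> :: real) \<in> borel_measurable M"
      using E by (intro borel_measurable_sum borel_measurable_indicator)
    also have "(\<lambda>\<omega>. \<Sum>j\<in>J. indicator (E j) \<omega> :: real) = (\<lambda>\<omega>. real (card {j \<in> J. \<omega> \<in> E j}))"
      unfolding indicator_def by (simp add: Int_def J_def)
    finally have [measurable]: "(\<lambda>\<omega>. real (card {j \<in> J. \<omega> \<in> E j})) \<in> borel_measurable M" .
    show "{\<omega> \<in> space M. real (card {j \<in> J. \<omega> \<in> E j}) \<le> a} \<in> events" by measurable
  qed
  also have "\<dots> \<le> S / (S - a)\<^sup>2"
    using pairwise_indep_events_lower_tail [of J E a] E pair a finite_J by (simp add: S_sum)
  finally show ?thesis .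
qed

lemma benjamini_hochberg_measurable:
  assumes \<alpha>: "0 \<le> \<alpha>" and i: "i \<in> {1..m}"
  shows "{x \<in> space (\<Pi>\<^sub>M i\<in>{1..m}. borel). i \<in> benjamini_hochberg m \<sigma> \<alpha> x} \<in>
    sets (\<Pi>\<^sub>M i\<in>{1..m}. (borel :: real measure))"
proof -
  let ?L = "\<Pi>\<^sub>M i\<in>{1..m}. (borel :: real measure)"
  have q: "(\<lambda>x. p_value \<sigma> (x j)) \<in> borel_measurable ?L" if "j \<in> {1..m}" for j
    using that by (intro measurable_compose [OF _ p_value_measurable] measurable_component_singleton)
  have n: "(\<lambda>x. real (bh_count m \<alpha> {} (\<lambda>j. p_value \<sigma> (x j)))) \<in> borel_measurable ?L"
    by (rule measurable_compose [OF measurable_bh_count [OF q]]) auto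
  show ?thesis
    unfolding benjamini_hochberg_iff [OF \<alpha> i]
    by (rule borel_measurable_le [OF q [OF i]])
       (intro borel_measurable_divide borel_measurable_times n borel_measurable_const)
qed

text \<open>The type II errors alone bound the optimal risk from below.\<close>

lemma optimal_risk_ge:
  assumes cost: "0 < \<delta>\<^sub>0" "0 < \<delta>\<^sub>A"
  shows "\<delta>\<^sub>A * (real m * p * central_mass (sqrt (oracle_threshold p \<sigma> \<tau> \<delta>\<^sub>0 \<delta>\<^sub>A * \<sigma>\<^sup>2 / (\<sigma>\<^sup>2 + \<tau>\<^sup>2)))) \<le>
    optimal_risk M m p \<sigma> \<tau> \<delta>\<^sub>0 \<delta>\<^sub>A \<nu> X"
proof -
  define t where "t = oracle_threshold p \<sigma> \<tau> \<delta>\<^sub>0 \<delta>\<^sub>A"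
  define B where "B = {x. x\<^sup>2 / \<sigma>\<^sup>2 < t}"
  let ?L = "\<Pi>\<^sub>M i\<in>{1..m}. (borel :: real measure)"
  have B: "B \<in> sets borel" unfolding B_def by measurable
  have "{x \<in> space ?L. i \<in> bayes_oracle m p \<sigma> \<tau> \<delta>\<^sub>0 \<delta>\<^sub>A x} \<in> sets ?L" if i: "i \<in> {1..m}" for i
  proof -
    have [measurable]: "(\<lambda>x. x i) \<in> borel_measurable ?L" using i by (rule measurable_component_singleton)
    have "{x \<in> space ?L. i \<in> bayes_oracle m p \<sigma> \<tau> \<delta>\<^sub>0 \<delta>\<^sub>A x} = {x \<in> space ?L. t \<le> (x i)\<^sup>2 / \<sigma>\<^sup>2}"
      using i by (auto simp: bayes_oracle_def t_def)
    also have "\<dots> \<in> sets ?L" by measurable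
    finally show ?thesis .
  qed
  then have "optimal_risk M m p \<sigma> \<tau> \<delta>\<^sub>0 \<delta>\<^sub>A \<nu> X = (\<Sum>i\<in>{1..m}.
      \<delta>\<^sub>0 * \<P>(\<omega> in M. \<not> \<nu> i \<omega> \<and> i \<in> bayes_oracle m p \<sigma> \<tau> \<delta>\<^sub>0 \<delta>\<^sub>A (observations m X \<omega>)) +
      \<delta>\<^sub>A * \<P>(\<omega> in M. \<nu> i \<omega> \<and> i \<notin> bayes_oracle m p \<sigma> \<tau> \<delta>\<^sub>0 \<delta>\<^sub>A (observations m X \<omega>)))"
    unfolding optimal_risk_def by (rule bayes_risk_eq_sum)
  also have "\<dots> \<ge> (\<Sum>i\<in>{1..m}. \<delta>\<^sub>A * (p * central_mass (sqrt (t * \<sigma>\<^sup>2 / (\<sigma>\<^sup>2 + \<tau>\<^sup>2)))))"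
  proof (rule sum_mono)
    fix i assume i: "i \<in> {1..m}"
    have iff: "(sqrt (\<sigma>\<^sup>2 + \<tau>\<^sup>2) * y)\<^sup>2 / \<sigma>\<^sup>2 < t \<longleftrightarrow> \<bar>y\<bar> < sqrt (t * \<sigma>\<^sup>2 / (\<sigma>\<^sup>2 + \<tau>\<^sup>2))" for y
    proof -
      have "(sqrt (\<sigma>\<^sup>2 + \<tau>\<^sup>2) * y)\<^sup>2 / \<sigma>\<^sup>2 < t \<longleftrightarrow> y\<^sup>2 < t * \<sigma>\<^sup>2 / (\<sigma>\<^sup>2 + \<tau>\<^sup>2)"
        using sigma_pos by (simp add: power_mult_distrib field_simps add_pos_nonneg)
      also have "\<dots> \<longleftrightarrow> sqrt (y\<^sup>2) < sqrt (t * \<sigma>\<^sup>2 / (\<sigma>\<^sup>2 + \<tau>\<^sup>2))"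
        by (simp only: real_sqrt_less_iff)
      finally show ?thesis by simp
    qed
    have "\<P>(\<omega> in M. \<nu> i \<omega> \<and> i \<notin> bayes_oracle m p \<sigma> \<tau> \<delta>\<^sub>0 \<delta>\<^sub>A (observations m X \<omega>)) =
        \<P>(\<omega> in M. \<nu> i \<omega> \<and> X i \<omega> \<in> B)"
      using i by (intro arg_cong [where f = prob])
        (auto simp: bayes_oracle_def observations_def B_def t_def not_le)
    also have "\<dots> = p * measure (centred_normal (sqrt (\<sigma>\<^sup>2 + \<tau>\<^sup>2))) B"
      by (rule prob_alternative_in [OF i B])
    also have "measure (centred_normal (sqrt (\<sigma>\<^sup>2 + \<tau>\<^sup>2))) B = central_mass (sqrt (t * \<sigma>\<^sup>2 / (\<sigma>\<^sup>2 + \<tau>\<^sup>2)))"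
      by (subst measure_centred_normal [OF sqrt_variance_pos B]) (simp only: B_def mem_Collect_eq iff central_mass_def)
    finally show "\<delta>\<^sub>A * (p * central_mass (sqrt (t * \<sigma>\<^sup>2 / (\<sigma>\<^sup>2 + \<tau>\<^sup>2)))) \<le>
        \<delta>\<^sub>0 * \<P>(\<omega> in M. \<not> \<nu> i \<omega> \<and> i \<in> bayes_oracle m p \<sigma> \<tau> \<delta>\<^sub>0 \<delta>\<^sub>A (observations m X \<omega>)) +
        \<delta>\<^sub>A * \<P>(\<omega> in M. \<nu> i \<omega> \<and> i \<notin> bayes_oracle m p \<sigma> \<tau> \<delta>\<^sub>0 \<delta>\<^sub>A (observations m X \<omega>))"
      using cost by simp
  qed
  finally show ?thesis by (simp add: t_def mult_ac)
qed

text \<open>A bound for the risk at a fixed number of tests, where \<open>\<beta>\<close> bounds the chance of few rejections.\<close>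

lemma benjamini_hochberg_risk_le:
  assumes cost: "0 < \<delta>\<^sub>0" "0 < \<delta>\<^sub>A" and \<alpha>: "0 < \<alpha>" "\<alpha> < 1" and c: "0 \<le> c"
    and k: "2 * exp (- c\<^sup>2 / 2) \<le> real k * \<alpha> / real m"
    and \<beta>: "\<And>i. i \<in> {1..m} \<Longrightarrow> \<P>(\<omega> in M. rejections \<alpha> {i} \<omega> \<in> {..<k}) \<le> \<beta>"
  shows "bayes_risk M m \<delta>\<^sub>0 \<delta>\<^sub>A \<nu> X (benjamini_hochberg m \<sigma> \<alpha>) \<le>
    \<delta>\<^sub>0 * (\<alpha> / (1 - \<alpha>) * (real m * p + 1 / (1 - \<alpha>))) +
    \<delta>\<^sub>A * (real m * p * (central_mass (c * \<sigma> / sqrt (\<sigma>\<^sup>2 + \<tau>\<^sup>2)) + \<beta>))"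
proof -
  let ?d = "benjamini_hochberg m \<sigma> \<alpha>"
  have "bayes_risk M m \<delta>\<^sub>0 \<delta>\<^sub>A \<nu> X ?d =
      \<delta>\<^sub>0 * (\<Sum>i\<in>{1..m}. \<P>(\<omega> in M. \<not> \<nu> i \<omega> \<and> i \<in> ?d (observations m X \<omega>))) +
      \<delta>\<^sub>A * (\<Sum>i\<in>{1..m}. \<P>(\<omega> in M. \<nu> i \<omega> \<and> i \<notin> ?d (observations m X \<omega>)))"
    using \<alpha> by (subst bayes_risk_eq_sum)
      (auto simp only: benjamini_hochberg_measurable less_imp_le sum.distrib sum_distrib_left)
  also have "\<dots> \<le> \<delta>\<^sub>0 * (\<alpha> / (1 - \<alpha>) * (real m * p + 1 / (1 - \<alpha>))) +
      \<delta>\<^sub>A * (\<Sum>i\<in>{1..m}. p * (central_mass (c * \<sigma> / sqrt (\<sigma>\<^sup>2 + \<tau>\<^sup>2)) + \<beta>))"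
  proof (intro add_mono mult_left_mono sum_mono sum_false_rejection_le)
    fix i assume i: "i \<in> {1..m}"
    have "\<P>(\<omega> in M. \<nu> i \<omega> \<and> i \<notin> ?d (observations m X \<omega>)) \<le>
        p * (central_mass (c * \<sigma> / sqrt (\<sigma>\<^sup>2 + \<tau>\<^sup>2)) + \<P>(\<omega> in M. rejections \<alpha> {i} \<omega> \<in> {..<k}))"
      using \<alpha> i c k by (intro false_acceptance_le)
    also have "\<dots> \<le> p * (central_mass (c * \<sigma> / sqrt (\<sigma>\<^sup>2 + \<tau>\<^sup>2)) + \<beta>)"
      using \<beta> [OF i] p_pos by (intro mult_left_mono add_left_mono) auto
    finally show "\<P>(\<omega> in M. \<nu> i \<omega> \<and> i \<notin> ?d (observations m X \<omega>)) \<le>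
        p * (central_mass (c * \<sigma> / sqrt (\<sigma>\<^sup>2 + \<tau>\<^sup>2)) + \<beta>)" .
  qed (use \<alpha> cost in auto)
  finally show ?thesis by (simp add: mult_ac)
qed

end


section \<open>Asymptotic optimality\<close>

text \<open>
  With \<open>L = ln (f / r)\<close> the hypotheses say that \<open>2 L\<close> agrees with \<open>ln v\<close> up to a factor tending to
  \<open>1\<close>, and that \<open>(\<delta> r)\<^sup>2 = exp (2 s L) / u\<close> is of smaller order than \<open>L / u\<close>, which
  converges.
\<close>

lemma level_asymptotics:
  fixes u f \<delta> r s :: "nat \<Rightarrow> real"
  assumes pos: "\<forall>\<^sub>F m in sequentially. 0 < u m \<and> 0 < f m \<and> 0 < \<delta> m \<and> 0 < r m"
    and v_lim: "filterlim (\<lambda>m. u m * (f m)\<^sup>2 * (\<delta> m)\<^sup>2) at_top sequentially"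
    and C_lim: "(\<lambda>m. ln (u m * (f m)\<^sup>2 * (\<delta> m)\<^sup>2) / u m) \<longlonglongrightarrow> C" and C_pos: "0 < C"
    and s_eq: "\<forall>\<^sub>F m in sequentially. ln (f m * \<delta> m * sqrt (u m)) / ln (f m / r m) = 1 + s m"
    and s_lim: "s \<longlonglongrightarrow> 0"
    and s_cond: "filterlim (\<lambda>m. 2 * s m * ln (f m / r m) - ln (ln (f m / r m))) at_bot sequentially"
  shows "\<forall>\<^sub>F m in sequentially. 0 < ln (f m / r m)"
    and "(\<lambda>m. ln (f m / r m) / u m) \<longlonglongrightarrow> C / 2"
    and "(\<lambda>m. \<delta> m * r m) \<longlonglongrightarrow> 0"
proof -
  define L where "L m = ln (f m / r m)" for m
  define H where "H m = ln (f m * \<delta> m * sqrt (u m))" for m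
  have H_eq: "\<forall>\<^sub>F m in sequentially. ln (u m * (f m)\<^sup>2 * (\<delta> m)\<^sup>2) = 2 * H m"
    using pos
  proof eventually_elim
    case (elim m)
    then have "u m * (f m)\<^sup>2 * (\<delta> m)\<^sup>2 = (f m * \<delta> m * sqrt (u m))\<^sup>2"
      by (simp add: power_mult_distrib)
    with elim show ?case by (simp add: H_def ln_realpow)
  qed
  have s1: "\<forall>\<^sub>F m in sequentially. 0 < 1 + s m"
    using order_tendstoD(1) [OF s_lim, of "-1"] by (auto elim: eventually_mono)
  have "\<forall>\<^sub>F m in sequentially. 1 < u m * (f m)\<^sup>2 * (\<delta> m)\<^sup>2"
    using v_lim by (simp add: filterlim_at_top_dense)
  with H_eq have H_pos: "\<forall>\<^sub>F m in sequentially. 0 < H m"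
    by eventually_elim (metis ln_gt_zero zero_less_mult_pos zero_less_numeral)
  have L_eq: "\<forall>\<^sub>F m in sequentially. L m = H m / (1 + s m)"
    using s_eq s1 H_pos
  proof eventually_elim
    case (elim m)
    then have "H m / L m = 1 + s m" by (simp add: H_def L_def)
    moreover from this elim have "L m \<noteq> 0" by auto
    ultimately show ?case using elim by (simp add: field_simps)
  qed
  show L_pos: "\<forall>\<^sub>F m in sequentially. 0 < ln (f m / r m)"
    using L_eq H_pos s1 by eventually_elim (simp add: L_def)
  have "(\<lambda>m. ln (u m * (f m)\<^sup>2 * (\<delta> m)\<^sup>2) / u m / 2 / (1 + s m)) \<longlonglongrightarrow> C / 2 / (1 + 0)"
    by (intro tendsto_intros C_lim s_lim) simp_all
  moreover have "\<forall>\<^sub>F m in sequentially.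
      ln (u m * (f m)\<^sup>2 * (\<delta> m)\<^sup>2) / u m / 2 / (1 + s m) = L m / u m"
    using L_eq H_eq by eventually_elim simp
  ultimately show Lu: "(\<lambda>m. ln (f m / r m) / u m) \<longlonglongrightarrow> C / 2"
    by (simp add: tendsto_cong L_def)
  define Y where "Y m = (2 * s m * L m - ln (L m)) + ln (L m / u m)" for m
  have "filterlim Y at_bot sequentially"
    unfolding Y_def [abs_def] L_def add.commute [of _ "ln (_ / _)"]
    using filterlim_tendsto_add_at_bot_iff [OF tendsto_ln [OF Lu]] s_cond C_pos
    by simp
  then have "filterlim (\<lambda>m. 1 / 2 * Y m) at_bot sequentially"
    by (subst filterlim_tendsto_pos_mult_at_bot_iff [OF tendsto_const]) auto
  then have "(\<lambda>m. exp (1 / 2 * Y m)) \<longlonglongrightarrow> 0"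
    by (rule filterlim_compose [OF exp_at_bot])
  moreover have "\<forall>\<^sub>F m in sequentially. exp (1 / 2 * Y m) = \<delta> m * r m"
    using pos L_pos L_eq s1
  proof eventually_elim
    case (elim m)
    have "ln (\<delta> m * r m) = H m - ln (u m) / 2 - L m"
      using elim by (simp add: H_def L_def ln_mult ln_div ln_sqrt)
    also have "H m = L m * (1 + s m)" using elim by simp
    also have "L m * (1 + s m) - ln (u m) / 2 - L m = 1 / 2 * Y m"
    proof -
      have "0 < L m" using elim(2) by (simp only: L_def)
      then have "ln (L m / u m) = ln (L m) - ln (u m)" using elim(1) by (simp add: ln_div)
      then show ?thesis by (simp add: Y_def algebra_simps)
    qed
    finally have "exp (1 / 2 * Y m) = exp (ln (\<delta> m * r m))" by simp
    with elim show ?case by simp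
  qed
  ultimately show "(\<lambda>m. \<delta> m * r m) \<longlonglongrightarrow> 0" by (simp add: tendsto_cong)
qed

lemma (in two_groups_model) oracle_threshold_scaled:
  assumes "u = \<tau>\<^sup>2 / \<sigma>\<^sup>2"
  shows "oracle_threshold p \<sigma> \<tau> \<delta>\<^sub>0 \<delta>\<^sub>A * \<sigma>\<^sup>2 / (\<sigma>\<^sup>2 + \<tau>\<^sup>2) =
    ln (u * ((1 - p) / p)\<^sup>2 * (\<delta>\<^sub>0 / \<delta>\<^sub>A)\<^sup>2) / u + ln (1 + 1 / u) / u"
proof -
  have u: "0 < u" using sigma_pos tau_pos by (simp add: assms)
  have "\<sigma>\<^sup>2 + \<tau>\<^sup>2 = \<sigma>\<^sup>2 * (1 + u)" using sigma_pos by (simp add: assms field_simps)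
  then have "\<sigma>\<^sup>2 / (\<sigma>\<^sup>2 + \<tau>\<^sup>2) = 1 / (1 + u)" using sigma_pos by simp
  moreover have "(1 + 1 / u) * (1 / (1 + u)) = 1 / u"
    using u by (simp add: divide_simps add.commute)
  ultimately have "x * ((1 + 1 / u) * (\<sigma>\<^sup>2 / (\<sigma>\<^sup>2 + \<tau>\<^sup>2))) = x * (1 / u)" for x by simp
  then have eq: "(1 + 1 / u) * x * \<sigma>\<^sup>2 / (\<sigma>\<^sup>2 + \<tau>\<^sup>2) = x / u" for x
    by (simp add: ac_simps)
  show ?thesis
    unfolding oracle_threshold_def Let_def assms [symmetric] eq by (rule add_divide_distrib)
qed

lemma (in two_groups_model) scaled_threshold:
  assumes "u = \<tau>\<^sup>2 / \<sigma>\<^sup>2"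
  shows "c * \<sigma> / sqrt (\<sigma>\<^sup>2 + \<tau>\<^sup>2) = c / sqrt (1 + u)"
proof -
  have "\<sigma>\<^sup>2 + \<tau>\<^sup>2 = \<sigma>\<^sup>2 * (1 + u)" using sigma_pos by (simp add: assms field_simps)
  then show ?thesis using sigma_pos by (simp add: real_sqrt_mult)
qed

theorem theorem5p2:
  fixes M :: "nat \<Rightarrow> 'a measure"
    and \<nu> :: "nat \<Rightarrow> nat \<Rightarrow> 'a \<Rightarrow> bool" and X :: "nat \<Rightarrow> nat \<Rightarrow> 'a \<Rightarrow> real"
    and p \<sigma> \<tau> \<delta>\<^sub>0 \<delta>\<^sub>A \<alpha> u f \<delta> v r s\<^sub>m :: "nat \<Rightarrow> real"
    and C \<alpha>\<^sub>l\<^sub>i\<^sub>m :: real and s :: ereal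
  assumes model: "\<And>m. m \<ge> 1 \<Longrightarrow> two_groups_model (M m) m (p m) (\<sigma> m) (\<tau> m) (\<nu> m) (X m)"
    and costs: "\<And>m. m \<ge> 1 \<Longrightarrow> \<delta>\<^sub>0 m > 0" "\<And>m. m \<ge> 1 \<Longrightarrow> \<delta>\<^sub>A m > 0"
    and u_def: "\<And>m. m \<ge> 1 \<Longrightarrow> u m = (\<tau> m)\<^sup>2 / (\<sigma> m)\<^sup>2"
    and f_def: "\<And>m. m \<ge> 1 \<Longrightarrow> f m = (1 - p m) / p m"
    and delta_def: "\<And>m. m \<ge> 1 \<Longrightarrow> \<delta> m = \<delta>\<^sub>0 m / \<delta>\<^sub>A m"
    and v_def: "\<And>m. m \<ge> 1 \<Longrightarrow> v m = u m * (f m)\<^sup>2 * (\<delta> m)\<^sup>2"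
    and p_lim: "p \<longlonglongrightarrow> 0"
    and u_lim: "filterlim u at_top sequentially"
    and v_lim: "filterlim v at_top sequentially"
    and C_lim: "(\<lambda>m. ln (v m) / u m) \<longlonglongrightarrow> C" and C_pos: "0 < C"
    and s_lim: "(\<lambda>m. ereal (real m * p m)) \<longlonglongrightarrow> s" and s_pos: "0 < s"
    and level: "\<And>m. m \<ge> 1 \<Longrightarrow> 0 < \<alpha> m \<and> \<alpha> m < 1"
    and level_lim: "\<alpha> \<longlonglongrightarrow> \<alpha>\<^sub>l\<^sub>i\<^sub>m" and level_lim_less: "\<alpha>\<^sub>l\<^sub>i\<^sub>m < 1"
    and r_def: "\<And>m. m \<ge> 1 \<Longrightarrow> r m = \<alpha> m / (1 - \<alpha> m)"
    and sm_def: "\<And>m. m \<ge> 1 \<Longrightarrow> ln (f m * \<delta> m * sqrt (u m)) / ln (f m / r m) = 1 + s\<^sub>m m"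
    and sm_lim: "s\<^sub>m \<longlonglongrightarrow> 0"
    and sm_cond: "filterlim (\<lambda>m. 2 * s\<^sub>m m * ln (f m / r m) - ln (ln (f m / r m))) at_bot sequentially"
  shows "abos
    (\<lambda>m. bayes_risk (M m) m (\<delta>\<^sub>0 m) (\<delta>\<^sub>A m) (\<nu> m) (X m) (benjamini_hochberg m (\<sigma> m) (\<alpha> m)))
    (\<lambda>m. optimal_risk (M m) m (p m) (\<sigma> m) (\<tau> m) (\<delta>\<^sub>0 m) (\<delta>\<^sub>A m) (\<nu> m) (X m))"
proof -
  define w where "w m = real m * p m * \<delta>\<^sub>A m" for m
  define R where "R m = bayes_risk (M m) m (\<delta>\<^sub>0 m) (\<delta>\<^sub>A m) (\<nu> m) (X m) (benjamini_hochberg m (\<sigma> m) (\<alpha> m))" for m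
  define R' where "R' m = optimal_risk (M m) m (p m) (\<sigma> m) (\<tau> m) (\<delta>\<^sub>0 m) (\<delta>\<^sub>A m) (\<nu> m) (X m)" for m
  define L where "L m = ln (f m / r m)" for m
  define G where "G = central_mass (sqrt C)"
  define \<gamma> where "\<gamma> = (1 - G) / 2"
  define few where "few m k i = measure (M m)
    {\<omega> \<in> space (M m). two_groups_model.rejections m (\<sigma> m) (X m) (\<alpha> m) {i} \<omega> \<in> {..<k}}" for m k and i :: nat
  have G: "0 < G" "G < 1"
    using C_pos by (simp_all add: G_def central_mass_pos central_mass_less_1)
  then have \<gamma>: "0 < \<gamma>" "\<gamma> < 1" by (auto simp: \<gamma>_def)
  note ge1 = eventually_ge_at_top [of "1 :: nat"]
  have p: "0 < p m" "p m < 1" "0 < \<sigma> m" "0 < \<tau> m" if "1 \<le> m" for m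
  proof -
    interpret two_groups_model "M m" m "p m" "\<sigma> m" "\<tau> m" "\<nu> m" "X m" by (rule model [OF that])
    show "0 < p m" "p m < 1" "0 < \<sigma> m" "0 < \<tau> m" by (fact p_pos p_less_1 sigma_pos tau_pos)+
  qed
  have pos: "0 < u m" "0 < f m" "0 < \<delta> m" "0 < r m" "0 < w m" if "1 \<le> m" for m
    using p [OF that] costs [OF that] level [OF that] that
    by (simp_all add: u_def f_def delta_def r_def w_def)
  have v_ev: "\<forall>\<^sub>F m in sequentially. v m = u m * (f m)\<^sup>2 * (\<delta> m)\<^sup>2"
    using ge1 by eventually_elim (rule v_def)
  have pos_ev: "\<forall>\<^sub>F m in sequentially. 0 < u m \<and> 0 < f m \<and> 0 < \<delta> m \<and> 0 < r m"
    using ge1 by eventually_elim (simp add: pos)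
  have v_lim': "filterlim (\<lambda>m. u m * (f m)\<^sup>2 * (\<delta> m)\<^sup>2) at_top sequentially"
    using v_lim filterlim_cong [OF refl refl v_ev] by simp
  have "\<forall>\<^sub>F m in sequentially. ln (v m) / u m = ln (u m * (f m)\<^sup>2 * (\<delta> m)\<^sup>2) / u m"
    using v_ev by eventually_elim simp
  with C_lim have C_lim': "(\<lambda>m. ln (u m * (f m)\<^sup>2 * (\<delta> m)\<^sup>2) / u m) \<longlonglongrightarrow> C"
    by (rule Lim_transform_eventually)
  have sm_ev: "\<forall>\<^sub>F m in sequentially. ln (f m * \<delta> m * sqrt (u m)) / ln (f m / r m) = 1 + s\<^sub>m m"
    using ge1 by eventually_elim (rule sm_def)
  note asym = level_asymptotics [OF pos_ev v_lim' C_lim' C_pos sm_ev sm_lim sm_cond, folded L_def]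
  have inv_u: "(\<lambda>m. 1 / u m) \<longlonglongrightarrow> 0"
    using tendsto_inverse_0_at_top [OF u_lim] by (simp add: inverse_eq_divide)

  \<comment> \<open>a bounded shift of \<open>L\<close> does not matter in the limit, as \<open>u\<close> tends to infinity\<close>
  have threshold: "(\<lambda>m. sqrt (2 * (L m + D)) / sqrt (1 + u m)) \<longlonglongrightarrow> sqrt C" for D
  proof -
    have "(\<lambda>m. sqrt (2 * (L m / u m + D * (1 / u m)) / (1 + 1 / u m))) \<longlonglongrightarrow> sqrt (2 * (C / 2 + D * 0) / (1 + 0))"
      by (intro tendsto_intros asym inv_u) simp_all
    moreover have "\<forall>\<^sub>F m in sequentially. sqrt (2 * (L m / u m + D * (1 / u m)) / (1 + 1 / u m)) =
        sqrt (2 * (L m + D)) / sqrt (1 + u m)"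
      using ge1
    proof eventually_elim
      case (elim m)
      have "2 * (L m / u m + D * (1 / u m)) = 2 * (L m + D) / u m" "1 + 1 / u m = (1 + u m) / u m"
        using pos(1) [OF elim] by (simp_all add: field_simps)
      then have "2 * (L m / u m + D * (1 / u m)) / (1 + 1 / u m) = 2 * (L m + D) / (1 + u m)"
        using pos(1) [OF elim] by simp
      then show ?case by (simp only: real_sqrt_divide)
    qed
    ultimately show ?thesis by (simp add: tendsto_cong)
  qed

  define \<epsilon> where "\<epsilon> = (1 - \<alpha>\<^sub>l\<^sub>i\<^sub>m) / 2"
  have \<epsilon>: "0 < \<epsilon>" using level_lim_less by (simp add: \<epsilon>_def)
  have "\<alpha>\<^sub>l\<^sub>i\<^sub>m < 1 - \<epsilon>" using level_lim_less by (simp add: \<epsilon>_def field_simps)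
  from order_tendstoD(2) [OF level_lim this]
  have \<alpha>_ev: "\<forall>\<^sub>F m in sequentially. \<epsilon> \<le> 1 - \<alpha> m" by eventually_elim simp
  have p_ev: "\<forall>\<^sub>F m in sequentially. 1 / 2 \<le> 1 - p m"
    using order_tendstoD(2) [OF p_lim, of "1 / 2"] by (auto elim: eventually_mono)

  \<comment> \<open>the left-hand side is \<open>2 exp (- D) r / f\<close>, which is compared with \<open>k \<alpha> / m\<close>; the constant \<open>D\<close> makes up
    for the bound \<open>B\<close> on \<open>m p / k\<close> and for the factors \<open>1 - p\<close> and \<open>1 - \<alpha>\<close> in \<open>f / r\<close>\<close>
  have level_k: "2 * exp (- (sqrt (2 * (L m + D)))\<^sup>2 / 2) \<le> k * \<alpha> m / real m"
    if m: "1 \<le> m" and L: "0 < L m" and \<alpha>: "\<epsilon> \<le> 1 - \<alpha> m" and ph: "1 / 2 \<le> 1 - p m"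
      and B: "0 < B" "real m * p m \<le> B * k" and D: "D = ln (1 + 4 * B / \<epsilon>)" for m k B D
  proof -
    have B1: "1 < 1 + 4 * B / \<epsilon>" using B \<epsilon> by simp
    then have D0: "0 < D" by (simp add: D)
    have "2 * exp (- (sqrt (2 * (L m + D)))\<^sup>2 / 2) = 2 * (exp (- L m) * exp (- D))"
      using L D0 by (simp flip: exp_add)
    also have "exp (- L m) = r m / f m"
      using pos [OF m] by (simp add: L_def exp_minus)
    also have "r m / f m = p m * \<alpha> m / ((1 - p m) * (1 - \<alpha> m))"
      using m p [OF m] by (simp add: r_def f_def mult.commute)
    also have "exp (- D) = 1 / (1 + 4 * B / \<epsilon>)"
      using B1 by (simp add: D exp_minus inverse_eq_divide)
    also have "2 * (p m * \<alpha> m / ((1 - p m) * (1 - \<alpha> m)) * (1 / (1 + 4 * B / \<epsilon>))) \<le>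
        2 * (p m * \<alpha> m / (1 / 2 * \<epsilon>) * (1 / (4 * B / \<epsilon>)))"
      using ph \<alpha> B \<epsilon> p [OF m] level [OF m]
      by (intro mult_left_mono mult_mono frac_le) (auto intro!: mult_mono mult_nonneg_nonneg divide_nonneg_nonneg)
    also have "\<dots> = p m * \<alpha> m / B" using B \<epsilon> by (simp add: field_simps)
    also have "\<dots> \<le> k * \<alpha> m / real m"
    proof -
      have "real m * p m * \<alpha> m \<le> B * k * \<alpha> m" using B level [OF m] by (intro mult_right_mono) auto
      then show ?thesis using B m by (simp add: field_simps)
    qed
    finally show ?thesis .
  qed

  \<comment> \<open>for some \<open>k\<close> of the order of \<open>m p\<close>, fewer than \<open>k\<close> rejections have probability tending to \<open>0\<close>,
    uniformly in the index of the p-value that is set to \<open>0\<close>\<close>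
  have main: "\<exists>D k b. b \<longlonglongrightarrow> 0 \<and> (\<forall>\<^sub>F m in sequentially. 0 \<le> D \<and>
      2 * exp (- (sqrt (2 * (L m + D)))\<^sup>2 / 2) \<le> real (k m) * \<alpha> m / real m \<and>
      (\<forall>i\<in>{1..m}. few m (k m) i \<le> b m))"
  proof (cases "s = \<infinity>")
    case False
    with s_pos obtain s' where s': "s = ereal s'" by (cases s) auto
    \<comment> \<open>\<open>m p\<close> is bounded, and \<open>k = 1\<close> suffices, since setting one p-value to \<open>0\<close> forces a rejection\<close>
    define B where "B = max 1 (s' + 1)"
    have sB: "s' < B" by (simp add: B_def less_max_iff_disj)
    have "\<forall>\<^sub>F m in sequentially. real m * p m < B"
      using order_tendstoD(2) [OF s_lim, of "ereal B"] sB by (simp add: s')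
    then have "\<forall>\<^sub>F m in sequentially. 0 \<le> ln (1 + 4 * B / \<epsilon>) \<and>
        2 * exp (- (sqrt (2 * (L m + ln (1 + 4 * B / \<epsilon>))))\<^sup>2 / 2) \<le> real 1 * \<alpha> m / real m \<and>
        (\<forall>i\<in>{1..m}. few m 1 i \<le> 0)"
      using ge1 asym(1) \<alpha>_ev p_ev
    proof eventually_elim
      case (elim m)
      interpret two_groups_model "M m" m "p m" "\<sigma> m" "\<tau> m" "\<nu> m" "X m" using elim by (intro model)
      have "0 \<le> ln (1 + 4 * B / \<epsilon>)" using \<epsilon> by (simp add: B_def)
      moreover have "few m 1 i \<le> 0" if i: "i \<in> {1..m}" for i
      proof -
        have "rejections (\<alpha> m) {i} \<omega> \<notin> {..<1}" for \<omega>
          using bh_count_pos [OF i, of "{i}"] by (simp add: rejections_def Suc_le_eq)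
        then have "{\<omega> \<in> space (M m). rejections (\<alpha> m) {i} \<omega> \<in> {..<1}} = {}" by blast
        then show ?thesis by (simp only: few_def measure_empty)
      qed
      moreover have "2 * exp (- (sqrt (2 * (L m + ln (1 + 4 * B / \<epsilon>))))\<^sup>2 / 2) \<le> real 1 * \<alpha> m / real m"
        using elim by (intro level_k [where B = B]) (auto simp: B_def)
      ultimately show ?case by blast
    qed
    moreover have "(\<lambda>_ :: nat. 0 :: real) \<longlonglongrightarrow> 0" by simp
    ultimately show ?thesis by (intro exI [of _ "ln (1 + 4 * B / \<epsilon>)"] exI [of _ "\<lambda>_. 1"] exI [of _ "\<lambda>_. 0"]) blast
  next
    case True
    \<comment> \<open>on average about \<open>2 \<gamma> m p\<close> true effects exceed the threshold, and only \<open>\<gamma> m p / 2\<close> are needed\<close>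
    define D where "D = ln (1 + 4 * (2 / \<gamma>) / \<epsilon>)"
    define a where "a m = \<gamma> / 2 * (real m * p m)" for m
    define k where "k m = nat \<lceil>a m\<rceil>" for m
    define g where "g m = 1 - central_mass (sqrt (2 * (L m + D)) / sqrt (1 + u m))" for m
    define S where "S m = (real m - 1) * p m * g m" for m
    have mp: "filterlim (\<lambda>m. real m * p m) at_top sequentially"
      using s_lim by (simp add: True tendsto_PInfty_eq_at_top)
    have "g \<longlonglongrightarrow> 1 - G"
      unfolding g_def [abs_def] G_def
      using C_pos by (intro tendsto_intros tendsto_central_mass threshold) auto
    moreover have "(\<lambda>m. 1 - 1 / real m) \<longlonglongrightarrow> 1 - 0"
      by (intro tendsto_intros lim_1_over_n)
    ultimately have "(\<lambda>m. (1 - 1 / real m) * g m) \<longlonglongrightarrow> (1 - 0) * (1 - G)"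
      by (intro tendsto_mult)
    also have "(1 - 0) * (1 - G) = 2 * \<gamma>" by (simp add: \<gamma>_def field_simps)
    finally have gg: "(\<lambda>m. (1 - 1 / real m) * g m) \<longlonglongrightarrow> 2 * \<gamma>" .
    have S_eq: "S m = (1 - 1 / real m) * g m * (real m * p m)" if "1 \<le> m" for m
      using that by (simp add: S_def field_simps)
    have "\<gamma> / 2 < 2 * \<gamma>" using \<gamma> by simp
    note gg_ev = order_tendstoD(1) [OF gg this]
    have b: "(\<lambda>m. S m / (S m - a m)\<^sup>2) \<longlonglongrightarrow> 0"
    proof -
      have "(\<lambda>m. (1 - 1 / real m) * g m / ((1 - 1 / real m) * g m - \<gamma> / 2)\<^sup>2 * inverse (real m * p m)) \<longlonglongrightarrow>
          2 * \<gamma> / (2 * \<gamma> - \<gamma> / 2)\<^sup>2 * 0"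
        using \<gamma> by (intro tendsto_intros gg tendsto_inverse_0_at_top [OF mp]) auto
      moreover have "\<forall>\<^sub>F m in sequentially. (1 - 1 / real m) * g m /
          ((1 - 1 / real m) * g m - \<gamma> / 2)\<^sup>2 * inverse (real m * p m) = S m / (S m - a m)\<^sup>2"
        using ge1
      proof eventually_elim
        case (elim m)
        have "x / (x - y)\<^sup>2 * inverse z = x * z / (x * z - y * z)\<^sup>2" if "z \<noteq> 0" for x y z :: real
        proof -
          have "x * z / (x * z - y * z)\<^sup>2 = x * z / ((x - y)\<^sup>2 * (z * z))"
            by (simp only: left_diff_distrib [symmetric] power_mult_distrib power2_eq_square [of z])
          then show ?thesis using that by (simp add: inverse_eq_divide)
        qed
        from this [of "real m * p m" "(1 - 1 / real m) * g m" "\<gamma> / 2"] show ?case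
          using elim p [OF elim] by (simp add: S_eq a_def)
      qed
      ultimately show ?thesis by (simp add: tendsto_cong)
    qed
    have "\<forall>\<^sub>F m in sequentially. 0 \<le> D \<and>
        2 * exp (- (sqrt (2 * (L m + D)))\<^sup>2 / 2) \<le> real (k m) * \<alpha> m / real m \<and>
        (\<forall>i\<in>{1..m}. few m (k m) i \<le> S m / (S m - a m)\<^sup>2)"
      using ge1 asym(1) \<alpha>_ev p_ev gg_ev
    proof eventually_elim
      case (elim m)
      interpret two_groups_model "M m" m "p m" "\<sigma> m" "\<tau> m" "\<nu> m" "X m" using elim by (intro model)
      have mp_pos: "0 < real m * p m" using elim p [OF elim(1)] by simp
      then have a_pos: "0 < a m" using \<gamma> by (simp add: a_def)
      have k: "a m \<le> real (k m)" "real (k m) - 1 \<le> a m" using a_pos by (auto simp: k_def)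
      have "a m \<le> 1 * (real m * 1)"
        unfolding a_def using \<gamma> p [OF elim(1)] by (intro mult_mono) auto
      then have km: "k m \<le> m" by (simp add: k_def nat_le_iff ceiling_le_iff)
      have D: "0 \<le> D" using \<gamma> \<epsilon> by (simp add: D_def)
      have lev: "2 * exp (- (sqrt (2 * (L m + D)))\<^sup>2 / 2) \<le> real (k m) * \<alpha> m / real m"
      proof (rule level_k [OF elim(1-4), where B = "2 / \<gamma>"])
        show "real m * p m \<le> 2 / \<gamma> * real (k m)" using k(1) \<gamma> by (simp add: a_def field_simps)
      qed (use \<gamma> in \<open>auto simp: D_def\<close>)
      have aS: "a m < S m"
        unfolding a_def S_eq [OF elim(1)] using elim mp_pos by (intro mult_strict_right_mono)
      have S: "S m = (real m - 1) * p m * (1 - central_mass (sqrt (2 * (L m + D)) * \<sigma> m / sqrt ((\<sigma> m)\<^sup>2 + (\<tau> m)\<^sup>2)))"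
        by (simp add: S_def g_def scaled_threshold [OF u_def [OF elim(1)]])
      have "few m (k m) i \<le> S m / (S m - a m)\<^sup>2" if i: "i \<in> {1..m}" for i
        unfolding few_def using level [OF elim(1)] elim D
        by (intro few_rejections_le [OF _ i _ km lev S k(2) aS]) auto
      with D lev show ?case by blast
    qed
    with b show ?thesis by (intro exI [of _ D] exI [of _ k] exI [of _ "\<lambda>m. S m / (S m - a m)\<^sup>2"]) blast
  qed
  then obtain D k b where b_lim: "b \<longlonglongrightarrow> 0" and main_ev: "\<forall>\<^sub>F m in sequentially. 0 \<le> D \<and>
      2 * exp (- (sqrt (2 * (L m + D)))\<^sup>2 / 2) \<le> real (k m) * \<alpha> m / real m \<and>
      (\<forall>i\<in>{1..m}. few m (k m) i \<le> b m)"
    by blast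

  obtain e where e: "0 < e" "\<forall>\<^sub>F m in sequentially. e < real m * p m"
  proof -
    obtain z where z: "0 < ereal z" "ereal z < s" using ereal_dense2 [OF s_pos] by blast
    with order_tendstoD(1) [OF s_lim z(2)] that [of z] show thesis by simp
  qed
  \<comment> \<open>bounds for the two risks, divided by \<open>w\<close>\<close>
  define up where "up m = \<delta> m * r m * (1 + 1 / (\<epsilon> * e)) +
    (central_mass (sqrt (2 * (L m + D)) / sqrt (1 + u m)) + b m)" for m
  define low where "low m = central_mass (sqrt (ln (u m * (f m)\<^sup>2 * (\<delta> m)\<^sup>2) / u m + ln (1 + 1 / u m) * (1 / u m)))" for m
  have "up \<longlonglongrightarrow> 0 * (1 + 1 / (\<epsilon> * e)) + (G + 0)"
    unfolding up_def [abs_def] G_def using C_pos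
    by (intro tendsto_intros asym(3) b_lim tendsto_central_mass threshold) auto
  then have up_lim: "up \<longlonglongrightarrow> G" by simp
  have "(\<lambda>m. sqrt (ln (u m * (f m)\<^sup>2 * (\<delta> m)\<^sup>2) / u m + ln (1 + 1 / u m) * (1 / u m))) \<longlonglongrightarrow>
      sqrt (C + ln (1 + 0) * 0)"
    by (intro tendsto_intros C_lim' inv_u) simp
  then have low_lim: "low \<longlonglongrightarrow> G"
    unfolding low_def [abs_def] G_def using C_pos by (intro tendsto_central_mass) auto
  have R_le: "\<forall>\<^sub>F m in sequentially. R m \<le> w m * up m"
    using ge1 asym(1) \<alpha>_ev main_ev e(2)
  proof eventually_elim
    case (elim m)
    interpret two_groups_model "M m" m "p m" "\<sigma> m" "\<tau> m" "\<nu> m" "X m" using elim by (intro model)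
    note \<alpha> = level [OF elim(1)]
    have "R m \<le> \<delta>\<^sub>0 m * (\<alpha> m / (1 - \<alpha> m) * (real m * p m + 1 / (1 - \<alpha> m))) +
        \<delta>\<^sub>A m * (real m * p m * (central_mass (sqrt (2 * (L m + D)) * \<sigma> m / sqrt ((\<sigma> m)\<^sup>2 + (\<tau> m)\<^sup>2)) + b m))"
      unfolding R_def
    proof (rule benjamini_hochberg_risk_le [OF costs [OF elim(1)], where k = "k m"])
      show "2 * exp (- (sqrt (2 * (L m + D)))\<^sup>2 / 2) \<le> real (k m) * \<alpha> m / real m" using elim(4) by blast
      show "\<P>(\<omega> in M m. rejections (\<alpha> m) {i} \<omega> \<in> {..<k m}) \<le> b m" if "i \<in> {1..m}" for i
        using elim(4) that unfolding few_def by blast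
    qed (use \<alpha> elim in simp_all)
    also have "\<delta>\<^sub>0 m * (\<alpha> m / (1 - \<alpha> m) * (real m * p m + 1 / (1 - \<alpha> m))) \<le>
        w m * (\<delta> m * r m * (1 + 1 / (\<epsilon> * e)))"
    proof -
      have "1 / (1 - \<alpha> m) \<le> 1 / \<epsilon>" using \<epsilon> elim by (intro divide_left_mono) (auto intro!: mult_pos_pos)
      also have "\<dots> \<le> real m * p m / (\<epsilon> * e)" using \<epsilon> e(1) elim by (simp add: field_simps)
      finally have "real m * p m + 1 / (1 - \<alpha> m) \<le> real m * p m * (1 + 1 / (\<epsilon> * e))"
        by (simp add: distrib_left)
      then have "\<delta>\<^sub>0 m * (r m * (real m * p m + 1 / (1 - \<alpha> m))) \<le>
          \<delta>\<^sub>0 m * (r m * (real m * p m * (1 + 1 / (\<epsilon> * e))))"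
        using costs(1) [OF elim(1)] pos(4) [OF elim(1)] by (intro mult_left_mono) auto
      also have "\<dots> = w m * (\<delta> m * r m * (1 + 1 / (\<epsilon> * e)))"
        using costs [OF elim(1)] by (simp add: w_def delta_def [OF elim(1)])
      finally show ?thesis by (simp add: r_def [OF elim(1)])
    qed
    finally show ?case
      unfolding scaled_threshold [OF u_def [OF elim(1)]]
      by (simp add: up_def w_def distrib_left mult_ac)
  qed
  have bounds: "w m * low m \<le> R' m" "R' m \<le> R m" if m: "1 \<le> m" for m
  proof -
    interpret two_groups_model "M m" m "p m" "\<sigma> m" "\<tau> m" "\<nu> m" "X m" using m by (intro model)
    show "R' m \<le> R m"
      unfolding R'_def R_def using costs [OF m] level [OF m]
      by (intro bayes_oracle_minimizes_risk benjamini_hochberg_measurable) auto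
    show "w m * low m \<le> R' m"
      using optimal_risk_ge [OF costs [OF m]]
      unfolding R'_def oracle_threshold_scaled [OF u_def [OF m]]
      by (simp add: w_def low_def f_def [OF m] delta_def [OF m] mult_ac)
  qed
  have low_ev: "\<forall>\<^sub>F m in sequentially. 0 < low m" using order_tendstoD(1) [OF low_lim G(1)] .
  have "(\<lambda>m. up m / low m) \<longlonglongrightarrow> G / G" using G by (intro tendsto_divide up_lim low_lim) auto
  then have ratio: "(\<lambda>m. up m / low m) \<longlonglongrightarrow> 1" using G by simp
  have "(\<lambda>m. R m / R' m) \<longlonglongrightarrow> 1"
  proof (rule tendsto_sandwich [OF _ _ tendsto_const ratio])
    show "\<forall>\<^sub>F m in sequentially. 1 \<le> R m / R' m"
      using low_ev ge1
    proof eventually_elim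
      case (elim m)
      then have "0 < R' m"
        using bounds(1) [of m] pos(5) [of m] by (meson less_le_trans mult_pos_pos)
      then show ?case using bounds(2) [of m] elim by simp
    qed
    show "\<forall>\<^sub>F m in sequentially. R m / R' m \<le> up m / low m"
      using low_ev ge1 R_le
    proof eventually_elim
      case (elim m)
      have wl: "0 < w m * low m" using elim pos(5) [of m] by simp
      then have "0 < R' m" "0 \<le> R m" using bounds [of m] elim by linarith+
      then have "R m / R' m \<le> w m * up m / (w m * low m)"
        using elim wl bounds(1) [of m] by (intro frac_le) auto
      also have "\<dots> = up m / low m" using pos(5) [of m] elim by simp
      finally show ?case .
    qed
  qed
  then show ?thesis by (simp add: abos_def R_def R'_def)
qed

end
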